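(* Let $k\ge 10$ and suppose that for each $1\le\ell'<k$ a number $\gamma(k,\ell')\ge 1$ is given, and set \[ \alpha_k:=\max_{1\le\ell'<k}\gamma(k,\ell')^{\frac{1}{\ell'(k-\ell')}} . \] Let $\mathcal{L}$ be a lattice of rank $n\ge k$, let $\tau\ge0$ be an integer and $1\le\ell<n$. Then the procedure $\mathcal{B}$ (described in the context), run on input $(\mathcal{L},\ell,\tau)$, makes at most $p(n)\cdot 2^{\tau}$ recursive invocations in total, for a fixed polynomial $p$ independent of $\mathcal{L},\ell,\tau,k$, and it returns a sublattice $\mathcal{L}'\subseteq\mathcal{L}$ of rank $\ell$ with \[ \frac{\det(\mathcal{L}')}{\det(\mathcal{L})^{\ell/n}}\le \alpha_k^{\ell(n-\ell)}\cdot 2^{\frac{\ell(n-\ell)n^2}{2^{\tau/2}}}. \]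
   Context: Lattices $\mathcal{L}\subset\mathbb{Q}^d$ have rank $n$ and determinant $\det(\mathcal{L})=\det(\mathbf B^T\mathbf B)^{1/2}$ for any basis $\mathbf B$. $\mathcal{L}^*=\{\mathbf w\in\mathrm{span}(\mathcal{L}):\langle \mathbf w,\mathbf y\rangle\in\mathbb Z\ \forall\mathbf y\in\mathcal{L}\}$ is the dual; for a lattice $\mathcal{M}$, $\mathcal{M}^\perp$ is the orthogonal complement of $\mathrm{span}(\mathcal{M})$; for a rank-$r$ sublattice $\mathcal{M}\subseteq\mathcal{L}^*$, $\mathcal{L}\cap\mathcal{M}^\perp$ is a sublattice of $\mathcal{L}$ of rank $\mathrm{rank}(\mathcal{L})-r$. Oracle: for each $1\le\ell'<k$, a DSP oracle which on a rank-$k$ lattice $\mathcal{M}$ returns a rank-$\ell'$ sublattice $\mathcal{M}'$ with $\det(\mathcal{M}')\le\gamma(k,\ell')\det(\mathcal{M})^{\ell'/k}$. LLL step: for a rank-$n$ lattice and $1\le\ell<n$, the lattice generated by the first $\ell$ vectors of an LLL-reduced basis is a rank-$\ell$ sublattice $\mathcal{L}'$ with $\det(\mathcal{L}')\le 2^{\ell(n-\ell)}\det(\mathcal{L})^{\ell/n}$ (known property used as base-case guarantee). Procedure $\mathcal{B}(\mathcal{L},\ell,\tau)$ with $n:=\mathrm{rank}(\mathcal{L})$: 1. Duality step: if $\ell>n/2$, output $\mathcal{L}\cap\mathcal{B}(\mathcal{L}^*,n-\ell,\tau)^\perp$. 2. Base cases: (a) if $n=k$, output the DSP oracle's answer for rank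 $\ell$ on $\mathcal{L}$; (b) if $\tau=0$, output the lattice generated by the first $\ell$ vectors of an LLL-reduced basis of $\mathcal{L}$. 3. Recursive step: otherwise set $\ell^*=\lceil (n-k)/20\rceil$, compute $\mathcal{M}:=\mathcal{B}(\mathcal{L}^*,\ell^*,\tau-1)$ and output $\mathcal{B}(\mathcal{L}\cap\mathcal{M}^\perp,\ell,\tau)$. *)

theory Defs
  imports "Jordan_Normal_Form.Determinant" "HOL-Computational_Algebra.Polynomial"
begin

definition lin_comb :: "nat \<Rightarrow> rat list \<Rightarrow> rat vec list \<Rightarrow> rat vec" where
  "lin_comb d cs bs = foldr (\<lambda>(c, b) acc. c \<cdot>\<^sub>v b + acc) (zip cs bs) (0\<^sub>v d)"

definition lin_indep :: "nat \<Rightarrow> rat vec list \<Rightarrow> bool" where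
  "lin_indep d bs \<longleftrightarrow> (\<forall>cs. length cs = length bs \<and> lin_comb d cs bs = 0\<^sub>v d \<longrightarrow> set cs \<subseteq> {0})"

definition gen_lattice :: "nat \<Rightarrow> rat vec list \<Rightarrow> rat vec set" where
  "gen_lattice d bs = {lin_comb d cs bs | cs. length cs = length bs \<and> set cs \<subseteq> \<int>}"

definition is_basis :: "nat \<Rightarrow> rat vec set \<Rightarrow> rat vec list \<Rightarrow> bool" where
  "is_basis d L bs \<longleftrightarrow> set bs \<subseteq> carrier_vec d \<and> lin_indep d bs \<and> L = gen_lattice d bs"

definition is_lattice :: "nat \<Rightarrow> rat vec set \<Rightarrow> bool" where
  "is_lattice d L \<longleftrightarrow> (\<exists>bs. is_basis d L bs)"

definition lat_basis :: "nat \<Rightarrow> rat vec set \<Rightarrow> rat vec list" where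
  "lat_basis d L = (SOME bs. is_basis d L bs)"

definition lat_rank :: "nat \<Rightarrow> rat vec set \<Rightarrow> nat" where
  "lat_rank d L = length (lat_basis d L)"

definition lat_det :: "nat \<Rightarrow> rat vec set \<Rightarrow> real" where
  "lat_det d L = (let B = mat_of_cols d (lat_basis d L) in
                   sqrt (real_of_rat (det (transpose_mat B * B))))"

text \<open>Rational linear span (the span of a rational lattice intersected with Q^d).\<close>
definition qspan :: "nat \<Rightarrow> rat vec set \<Rightarrow> rat vec set" where
  "qspan d S = {lin_comb d cs bs | cs bs. set bs \<subseteq> S \<and> length cs = length bs}"

definition dual_lat :: "nat \<Rightarrow> rat vec set \<Rightarrow> rat vec set" where
  "dual_lat d L = {w \<in> qspan d L. \<forall>y\<in>L. w \<bullet> y \<in> \<int>}"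

definition orth :: "nat \<Rightarrow> rat vec set \<Rightarrow> rat vec set" where
  "orth d M = {x \<in> carrier_vec d. \<forall>m\<in>M. x \<bullet> m = 0}"

text \<open>Executions of the procedure B(L, l, tau) with DSP oracle Orc and LLL step LLLf.
  Brun k d Orc LLLf L l tau out cnt: B on input (L,l,tau) returns out and makes
  cnt invocations of B in total (including the top-level one).\<close>
inductive Brun ::
  "nat \<Rightarrow> nat \<Rightarrow> (rat vec set \<Rightarrow> nat \<Rightarrow> rat vec set) \<Rightarrow> (rat vec set \<Rightarrow> nat \<Rightarrow> rat vec set)
   \<Rightarrow> rat vec set \<Rightarrow> nat \<Rightarrow> nat \<Rightarrow> rat vec set \<Rightarrow> nat \<Rightarrow> bool"
  for k d Orc LLLf where
  duality: "2 * l > lat_rank d L \<Longrightarrow>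
     Brun k d Orc LLLf (dual_lat d L) (lat_rank d L - l) tau M c \<Longrightarrow>
     Brun k d Orc LLLf L l tau (L \<inter> orth d M) (Suc c)"
| base_oracle: "\<not> 2 * l > lat_rank d L \<Longrightarrow> lat_rank d L = k \<Longrightarrow>
     Brun k d Orc LLLf L l tau (Orc L l) 1"
| base_lll: "\<not> 2 * l > lat_rank d L \<Longrightarrow> lat_rank d L \<noteq> k \<Longrightarrow> tau = 0 \<Longrightarrow>
     Brun k d Orc LLLf L l tau (LLLf L l) 1"
| recursive: "\<not> 2 * l > lat_rank d L \<Longrightarrow> lat_rank d L \<noteq> k \<Longrightarrow> tau \<noteq> 0 \<Longrightarrow>
     ls = nat \<lceil>(real (lat_rank d L) - real k) / 20\<rceil> \<Longrightarrow>
     Brun k d Orc LLLf (dual_lat d L) ls (tau - 1) M c1 \<Longrightarrow>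
     Brun k d Orc LLLf (L \<inter> orth d M) l tau out c2 \<Longrightarrow>
     Brun k d Orc LLLf L l tau out (Suc (c1 + c2))"

end

theory Submission
  imports Defs "Jordan_Normal_Form.Column_Operations"
begin

text \<open>
  Write a lattice as \<open>B \<int>\<^sup>n\<close>. If \<open>M\<close> is a sublattice of the dual of \<open>L\<close>, integer column operations give a
  basis \<open>B = [B1 | B2]\<close> of \<open>L\<close> for which the integer matrix \<open>W\<^sup>T B\<close>, with \<open>W\<close> a basis of \<open>M\<close>, is
  \<open>[H | 0]\<close> with \<open>H\<close> square and nonsingular. Then \<open>B2\<close> is a basis of \<open>L \<inter> M\<^sup>\<bottom>\<close>, and evaluating the
  Gram determinants of \<open>[W | B2] = B N\<close> gives
  \<open>(det H)\<^sup>2 det (L \<inter> M\<^sup>\<bottom>)\<^sup>2 = det L\<^sup>2 det M\<^sup>2\<close>, so \<open>det (L \<inter> M\<^sup>\<bottom>) \<le> det L det M\<close>.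

  Taking logarithms, both the duality step and the recursive step become linear in the logarithms of
  the determinants, and the powers of \<open>\<alpha>\<close> add up exactly. For the powers of two one needs
  \<open>(n - l - s) (n - s)\<^sup>2 + \<surd>2 s n\<^sup>2 \<le> (n - l) n\<^sup>2\<close> when \<open>10 s \<le> n\<close> and \<open>2 l \<le> n\<close>.

  With \<open>N = n - k\<close>, an invocation that does not start with a duality step costs at most
  \<open>2\<^sup>\<tau> 3 (N + 1)\<^sup>1\<^sup>5 - 2\<close>: replacing \<open>N\<close> by \<open>N - \<lceil>N / 20\<rceil>\<close> halves \<open>(N + 1)\<^sup>1\<^sup>5\<close>, which pays for the
  other branch, where \<open>\<tau>\<close> drops by one.
\<close>

subsection \<open>Bases as matrices\<close>

text \<open>Integrality is a predicate on rational vectors, and likewise on matrices below, so that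
  coefficient matrices multiply rational bases without any change of entry type.\<close>

definition int_vec :: "rat vec \<Rightarrow> bool" where
  "int_vec v \<longleftrightarrow> (\<forall>i<dim_vec v. v $ i \<in> \<int>)"

definition int_mat :: "rat mat \<Rightarrow> bool" where
  "int_mat A \<longleftrightarrow> (\<forall>i<dim_row A. \<forall>j<dim_col A. A $$ (i, j) \<in> \<int>)"

text \<open>Matrix counterpart of \<open>is_basis\<close>: injectivity of x \<mapsto> Bx is linear
  independence of the columns. The number \<open>n\<close> of columns is explicit because it is the
  rank.\<close>

definition basis_mat :: "nat \<Rightarrow> nat \<Rightarrow> rat vec set \<Rightarrow> rat mat \<Rightarrow> bool" where
  "basis_mat d n L B \<longleftrightarrow> B \<in> carrier_mat d n \<and>
     (\<forall>x\<in>carrier_vec n. B *\<^sub>v x = 0\<^sub>v d \<longrightarrow> x = 0\<^sub>v n) \<and>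
     L = {B *\<^sub>v x | x. x \<in> carrier_vec n \<and> int_vec x}"

lemma basis_matD:
  assumes "basis_mat d n L B"
  shows "B \<in> carrier_mat d n"
    and "\<And>x. x \<in> carrier_vec n \<Longrightarrow> B *\<^sub>v x = 0\<^sub>v d \<Longrightarrow> x = 0\<^sub>v n"
    and "L = {B *\<^sub>v x | x. x \<in> carrier_vec n \<and> int_vec x}"
  using assms by (auto simp: basis_mat_def)

lemma int_mat_mult_vec: "int_mat A \<Longrightarrow> int_vec x \<Longrightarrow> dim_vec x = dim_col A \<Longrightarrow> int_vec (A *\<^sub>v x)"
  by (auto simp: int_mat_def int_vec_def scalar_prod_def intro!: Ints_sum Ints_mult)

lemma int_mat_det: "int_mat A \<Longrightarrow> A \<in> carrier_mat n n \<Longrightarrow> det A \<in> \<int>"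
  by (auto simp: det_def int_mat_def sign_def intro!: Ints_sum Ints_mult Ints_prod)

lemma int_vec_unit: "int_vec (unit_vec n i)"
  by (auto simp: int_vec_def unit_vec_def)

lemma mat_mult_unit_vec:
  fixes B :: "'a::semiring_1 mat"
  assumes "B \<in> carrier_mat d n" "j < n"
  shows "B *\<^sub>v unit_vec n j = col B j"
  using assms by (auto simp: mult_mat_vec_def col_def intro!: eq_vecI)

lemma col_mem_lattice:
  assumes "basis_mat d n L B" "j < n"
  shows "col B j \<in> L"
proof -
  have "B *\<^sub>v unit_vec n j \<in> L"
    unfolding basis_matD(3)[OF assms(1)] by (auto intro: int_vec_unit)
  then show ?thesis
    using mat_mult_unit_vec[OF basis_matD(1)[OF assms(1)] assms(2)] by simp
qed

text \<open>Coefficient vectors chosen column by column are assembled into one matrix. The parameter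
  \<open>P\<close> carries extra information on them: \<open>int_vec\<close> for sublattices, the
  trivial predicate for vectors that only lie in the rational span.\<close>

lemma mat_factor_cols:
  assumes B: "B \<in> carrier_mat d n" and K: "K \<in> carrier_mat d m"
    and ex: "\<And>j. j < m \<Longrightarrow> \<exists>x\<in>carrier_vec n. P x \<and> col K j = B *\<^sub>v x"
  obtains N where "N \<in> carrier_mat n m" "K = B * N" "\<And>j. j < m \<Longrightarrow> P (col N j)"
proof -
  obtain f where f: "\<And>j. j < m \<Longrightarrow> f j \<in> carrier_vec n \<and> P (f j) \<and> col K j = B *\<^sub>v f j"
    using ex by metis
  define N where "N = mat_of_cols n (map f [0..<m])"
  have N: "N \<in> carrier_mat n m" by (simp add: N_def carrier_matI)
  have c: "col N j = f j" if "j < m" for j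
    using that f by (simp add: N_def)
  have "K = B * N"
  proof (rule mat_col_eqI)
    fix j assume "j < dim_col (B * N)"
    then have j: "j < m" using N by simp
    show "col K j = col (B * N) j"
      using f[OF j] c[OF j] col_mult2[OF B N j] by simp
  qed (use B K N in auto)
  then show ?thesis using that[OF N] c f by auto
qed

lemma mult_left_cancel_inj:
  assumes B: "B \<in> carrier_mat d n"
    and inj: "\<And>x. x \<in> carrier_vec n \<Longrightarrow> B *\<^sub>v x = 0\<^sub>v d \<Longrightarrow> x = 0\<^sub>v n"
    and X: "X \<in> carrier_mat n m" and Y: "Y \<in> carrier_mat n m"
    and eq: "B * X = B * Y"
  shows "X = (Y :: rat mat)"
proof (rule mat_col_eqI)
  fix j assume "j < dim_col Y"
  then have j: "j < m" using Y by simp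
  have cX: "col X j \<in> carrier_vec n" and cY: "col Y j \<in> carrier_vec n" using X Y by auto
  have "B *\<^sub>v col X j = B *\<^sub>v col Y j"
    using eq j B X Y by (metis col_mult2)
  then have "B *\<^sub>v (col X j - col Y j) = 0\<^sub>v d"
    using B cX cY by (simp add: mult_minus_distrib_mat_vec)
  then have z: "col X j - col Y j = 0\<^sub>v n" using inj cX cY by simp
  show "col X j = col Y j"
  proof (rule eq_vecI)
    fix i assume "i < dim_vec (col Y j)"
    then have i: "i < n" using cY by (simp only: carrier_vecD)
    then have "(col X j - col Y j) $ i = 0" using z by simp
    then show "col X j $ i = col Y j $ i" using i cX cY by (simp add: carrier_dim_vec)
  qed (use X Y in auto)
qed (use X Y in auto)

section \<open>Translation between lists of vectors and matrices\<close>

lemma set_list_of_vec_subset: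
  "set (list_of_vec x) \<subseteq> S \<longleftrightarrow> (\<forall>i<dim_vec x. x $ i \<in> S)"
  by (auto simp: set_conv_nth list_of_vec_index)

lemma int_vec_of_list: "set cs \<subseteq> \<int> \<Longrightarrow> int_vec (vec_of_list cs)"
  by (simp add: int_vec_def vec_of_list_index subset_iff)

text \<open>Bridge from the list-based definitions to matrices; the induction splits off the first
  column.\<close>

lemma lin_comb_mult_vec:
  "set bs \<subseteq> carrier_vec d \<Longrightarrow> length cs = length bs \<Longrightarrow>
    lin_comb d cs bs = mat_of_cols d bs *\<^sub>v vec_of_list cs"
proof (induction bs arbitrary: cs)
  case Nil
  then show ?case by (auto simp: lin_comb_def mult_mat_vec_def scalar_prod_def intro!: eq_vecI)
next
  case (Cons b bs)
  then obtain c cs' where cs: "cs = c # cs'" and l: "length cs' = length bs"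
    by (cases cs) auto
  have IH: "lin_comb d cs' bs = mat_of_cols d bs *\<^sub>v vec_of_list cs'"
    using Cons l by simp
  have "lin_comb d cs (b # bs) = c \<cdot>\<^sub>v b + lin_comb d cs' bs"
    by (simp add: lin_comb_def cs)
  also have "\<dots> = mat_of_cols d (b # bs) *\<^sub>v vec_of_list cs"
    unfolding IH
  proof (rule eq_vecI)
    fix i assume "i < dim_vec (mat_of_cols d (b # bs) *\<^sub>v vec_of_list cs)"
    then have i: "i < d" by simp
    have "b \<in> carrier_vec d" using Cons by simp
    then show "(c \<cdot>\<^sub>v b + mat_of_cols d bs *\<^sub>v vec_of_list cs') $ i
        = (mat_of_cols d (b # bs) *\<^sub>v vec_of_list cs) $ i"
      using i l
      by (simp add: scalar_prod_def cs sum.atLeast0_lessThan_Suc_shift mat_of_cols_Cons_index_0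
          mat_of_cols_Cons_index_Suc vec_of_list_index mat_of_cols_index del: sum.op_ivl_Suc)
  qed (use Cons in auto)
  finally show ?case .
qed

lemma basis_mat_of_is_basis:
  assumes "is_basis d L bs"
  shows "basis_mat d (length bs) L (mat_of_cols d bs)"
proof -
  have bs: "set bs \<subseteq> carrier_vec d" using assms by (simp add: is_basis_def)
  note lc = lin_comb_mult_vec[OF bs]
  show ?thesis unfolding basis_mat_def
  proof (intro conjI ballI impI)
    fix x :: "rat vec" assume x: "x \<in> carrier_vec (length bs)" "mat_of_cols d bs *\<^sub>v x = 0\<^sub>v d"
    have "lin_comb d (list_of_vec x) bs = 0\<^sub>v d"
      using lc[of "list_of_vec x"] x by (simp add: vec_list)
    then have "set (list_of_vec x) \<subseteq> {0}"
      using assms x by (auto simp: is_basis_def lin_indep_def)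
    then show "x = 0\<^sub>v (length bs)" using x(1)
      by (intro eq_vecI) (auto simp: set_list_of_vec_subset)
  next
    show "L = {mat_of_cols d bs *\<^sub>v x |x. x \<in> carrier_vec (length bs) \<and> int_vec x}" (is "_ = ?R")
    proof (intro equalityI subsetI)
      fix y assume "y \<in> L"
      then obtain cs where cs: "y = lin_comb d cs bs" "length cs = length bs" "set cs \<subseteq> \<int>"
        using assms by (auto simp: is_basis_def gen_lattice_def)
      moreover have "vec_of_list cs \<in> carrier_vec (length bs)" using cs by (simp add: carrier_dim_vec)
      ultimately show "y \<in> ?R" using lc[of cs] int_vec_of_list[of cs] by blast
    next
      fix y assume "y \<in> ?R"
      then obtain x where x: "y = mat_of_cols d bs *\<^sub>v x" "x \<in> carrier_vec (length bs)" "int_vec x"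
        by auto
      then have "y = lin_comb d (list_of_vec x) bs"
        using lc[of "list_of_vec x"] by (simp add: vec_list)
      moreover have "set (list_of_vec x) \<subseteq> \<int>"
        using x by (auto simp: int_vec_def set_list_of_vec_subset)
      ultimately show "y \<in> L"
        using assms x by (auto simp: is_basis_def gen_lattice_def intro!: exI[of _ "list_of_vec x"])
    qed
  qed simp
qed

lemma is_basis_of_basis_mat:
  assumes "basis_mat d n L B"
  shows "is_basis d L (cols B)"
proof -
  have B: "B \<in> carrier_mat d n" by (rule basis_matD(1)[OF assms])
  have bs: "set (cols B) \<subseteq> carrier_vec d" using B cols_dim by blast
  have M: "mat_of_cols d (cols B) = B" using B by auto
  have len: "length (cols B) = n" using B by simp
  note lc = lin_comb_mult_vec[OF bs, unfolded M len]
  show ?thesis unfolding is_basis_def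
  proof (intro conjI bs)
    show "lin_indep d (cols B)" unfolding lin_indep_def
    proof (intro allI impI, elim conjE)
      fix cs assume cs: "length cs = length (cols B)" "lin_comb d cs (cols B) = 0\<^sub>v d"
      then have "vec_of_list cs = 0\<^sub>v n"
        using basis_matD(2)[OF assms, of "vec_of_list cs"] lc len by (simp add: carrier_dim_vec)
      then have "cs = list_of_vec (0\<^sub>v n)" by (metis list_vec)
      then show "set cs \<subseteq> {0}" by (simp only: set_list_of_vec_subset) simp
    qed
    show "L = gen_lattice d (cols B)"
    proof (intro equalityI subsetI)
      fix y assume "y \<in> L"
      then obtain x where x: "y = B *\<^sub>v x" "x \<in> carrier_vec n" "int_vec x"
        using basis_matD(3)[OF assms] by auto
      then have "y = lin_comb d (list_of_vec x) (cols B)"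
        using lc[of "list_of_vec x"] by (simp add: vec_list)
      moreover have "set (list_of_vec x) \<subseteq> \<int>"
        using x by (auto simp: int_vec_def set_list_of_vec_subset)
      ultimately show "y \<in> gen_lattice d (cols B)"
        using x len by (auto simp: gen_lattice_def intro!: exI[of _ "list_of_vec x"])
    next
      fix y assume "y \<in> gen_lattice d (cols B)"
      then obtain cs where cs: "y = lin_comb d cs (cols B)" "length cs = n" "set cs \<subseteq> \<int>"
        using len by (auto simp: gen_lattice_def)
      moreover have "vec_of_list cs \<in> carrier_vec n" using cs by (simp add: carrier_dim_vec)
      ultimately show "y \<in> L" using lc[of cs] int_vec_of_list[of cs]
        unfolding basis_matD(3)[OF assms] by blast
    qed
  qed
qed

lemma is_latticeI: "basis_mat d n L B \<Longrightarrow> is_lattice d L"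
  unfolding is_lattice_def using is_basis_of_basis_mat by blast

lemma qspan_basis_mat:
  assumes "basis_mat d n L B"
  shows "qspan d L = {B *\<^sub>v x | x. x \<in> carrier_vec n}"
proof (intro equalityI subsetI)
  have B: "B \<in> carrier_mat d n" by (rule basis_matD(1)[OF assms])
  {
    fix y assume "y \<in> qspan d L"
    then obtain cs bs where y: "y = lin_comb d cs bs" "set bs \<subseteq> L" "length cs = length bs"
      by (auto simp: qspan_def)
    have Lc: "L \<subseteq> carrier_vec d" using B unfolding basis_matD(3)[OF assms] by auto
    then have bs: "set bs \<subseteq> carrier_vec d" using y by auto
    have K: "mat_of_cols d bs \<in> carrier_mat d (length bs)" by simp
    obtain N where N: "N \<in> carrier_mat n (length bs)" "mat_of_cols d bs = B * N"
    proof (rule mat_factor_cols[OF B K, where P = "\<lambda>_. True"])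
      fix j assume j: "j < length bs"
      then have "bs ! j \<in> L" "bs ! j \<in> carrier_vec d" using y bs by auto
      then show "\<exists>x\<in>carrier_vec n. True \<and> col (mat_of_cols d bs) j = B *\<^sub>v x"
        using j unfolding basis_matD(3)[OF assms] by auto
    qed blast
    have "y = B *\<^sub>v (N *\<^sub>v vec_of_list cs)"
      using lin_comb_mult_vec[OF bs y(3)] y N B
      by (simp add: assoc_mult_mat_vec[OF B N(1)] carrier_vecI)
    moreover have "N *\<^sub>v vec_of_list cs \<in> carrier_vec n" using N by (simp add: carrier_dim_vec)
    ultimately show "y \<in> {B *\<^sub>v x | x. x \<in> carrier_vec n}" by blast
  next
    fix y assume "y \<in> {B *\<^sub>v x | x. x \<in> carrier_vec n}"
    then obtain x where x: "y = B *\<^sub>v x" "x \<in> carrier_vec n" by auto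
    have bs: "set (cols B) \<subseteq> carrier_vec d" using B cols_dim by blast
    have "y = lin_comb d (list_of_vec x) (cols B)"
      using lin_comb_mult_vec[OF bs, of "list_of_vec x"] x B mat_of_cols_cols[of B] by (simp add: vec_list)
    moreover have "set (cols B) \<subseteq> L"
      using col_mem_lattice[OF assms] B by (auto simp: cols_def)
    ultimately show "y \<in> qspan d L"
      using x B by (auto simp: qspan_def intro!: exI[of _ "list_of_vec x"] exI[of _ "cols B"])
  }
qed

subsection \<open>Gram determinants\<close>

lemma four_block_det_diag:
  fixes A :: "rat mat"
  assumes "A \<in> carrier_mat n n" "D \<in> carrier_mat m m" "C \<in> carrier_mat m n" "B \<in> carrier_mat n m"
  shows "B = 0\<^sub>m n m \<Longrightarrow> det (four_block_mat A B C D) = det A * det D"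
    and "C = 0\<^sub>m m n \<Longrightarrow> det (four_block_mat A B C D) = det A * det D"
  using det_four_block_mat_upper_right_zero[of A n B m C D]
    det_four_block_mat_lower_left_zero[of A n B m C D] assms by auto

section \<open>Juxtaposition of matrices and block Gram matrices\<close>

definition hcat :: "rat mat \<Rightarrow> rat mat \<Rightarrow> rat mat" where
  "hcat A B = mat (dim_row A) (dim_col A + dim_col B)
     (\<lambda>(i, j). if j < dim_col A then A $$ (i, j) else B $$ (i, j - dim_col A))"

lemma hcat_carrier [simp]:
  "A \<in> carrier_mat d a \<Longrightarrow> B \<in> carrier_mat d b \<Longrightarrow> hcat A B \<in> carrier_mat d (a + b)"
  by (auto simp: hcat_def)

lemma col_hcat:
  assumes "A \<in> carrier_mat d a" "B \<in> carrier_mat d b" "j < a + b"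
  shows "col (hcat A B) j = (if j < a then col A j else col B (j - a))"
  using assms by (auto simp: hcat_def intro!: eq_vecI)

lemma hcat_split:
  assumes "B \<in> carrier_mat d (a + b)"
  obtains B1 B2 where "B1 \<in> carrier_mat d a" "B2 \<in> carrier_mat d b" "B = hcat B1 B2"
proof
  show "B = hcat (mat d a (\<lambda>(i, j). B $$ (i, j))) (mat d b (\<lambda>(i, j). B $$ (i, a + j)))"
    using assms by (auto simp: hcat_def intro!: eq_matI)
qed auto

lemma hcat_mult_vec:
  assumes A: "A \<in> carrier_mat d a" and B: "B \<in> carrier_mat d b"
    and x: "x \<in> carrier_vec a" and y: "y \<in> carrier_vec b"
  shows "hcat A B *\<^sub>v (x @\<^sub>v y) = A *\<^sub>v x + B *\<^sub>v y"
proof (rule eq_vecI)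
  fix i assume "i < dim_vec (A *\<^sub>v x + B *\<^sub>v y)"
  then have i: "i < d" using A B by simp
  have split: "{0..<a + b} = {0..<a} \<union> {a..<a + b}" by auto
  have "(hcat A B *\<^sub>v (x @\<^sub>v y)) $ i = (\<Sum>j\<in>{0..<a + b}. hcat A B $$ (i, j) * (x @\<^sub>v y) $ j)"
    using i A B x y by (simp add: scalar_prod_def hcat_def)
  also have "\<dots> = (\<Sum>j\<in>{0..<a}. A $$ (i, j) * x $ j) + (\<Sum>j\<in>{a..<a + b}. B $$ (i, j - a) * y $ (j - a))"
    unfolding split using i A B x y
    by (subst sum.union_disjoint) (auto simp: hcat_def)
  also have "(\<Sum>j\<in>{a..<a + b}. B $$ (i, j - a) * y $ (j - a)) = (\<Sum>j\<in>{0..<b}. B $$ (i, j) * y $ j)"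
    by (rule sum.reindex_bij_witness[of _ "\<lambda>j. j + a" "\<lambda>j. j - a"]) auto
  finally show "(hcat A B *\<^sub>v (x @\<^sub>v y)) $ i = (A *\<^sub>v x + B *\<^sub>v y) $ i"
    using i A B x y by (simp add: scalar_prod_def)
qed (use A B in \<open>auto simp: hcat_def\<close>)

lemma vec_append_split:
  assumes "x \<in> carrier_vec (a + b)"
  obtains y z where "y \<in> carrier_vec a" "z \<in> carrier_vec b" "x = y @\<^sub>v z"
  using assms by (metis vec_first_carrier vec_first_last_append vec_last_carrier)

text \<open>Each entry is the inner product of two columns, and the block it falls in is decided by
  the half from which each column comes.\<close>

lemma transpose_hcat_mult:
  assumes A: "A \<in> carrier_mat d a" and B: "B \<in> carrier_mat d b"
    and C: "C \<in> carrier_mat d a'" and D: "D \<in> carrier_mat d b'"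
  shows "(hcat A B)\<^sup>T * hcat C D = four_block_mat (A\<^sup>T * C) (A\<^sup>T * D) (B\<^sup>T * C) (B\<^sup>T * D)"
proof (rule eq_matI)
  fix i j assume "i < dim_row (four_block_mat (A\<^sup>T * C) (A\<^sup>T * D) (B\<^sup>T * C) (B\<^sup>T * D))"
    "j < dim_col (four_block_mat (A\<^sup>T * C) (A\<^sup>T * D) (B\<^sup>T * C) (B\<^sup>T * D))"
  then have ij: "i < a + b" "j < a' + b'" using assms by auto
  then have "((hcat A B)\<^sup>T * hcat C D) $$ (i, j) = col (hcat A B) i \<bullet> col (hcat C D) j"
    using hcat_carrier[OF A B] hcat_carrier[OF C D] by simp
  then show "((hcat A B)\<^sup>T * hcat C D) $$ (i, j) =
      four_block_mat (A\<^sup>T * C) (A\<^sup>T * D) (B\<^sup>T * C) (B\<^sup>T * D) $$ (i, j)"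
    using ij assms by (simp add: col_hcat[OF A B] col_hcat[OF C D])
qed (use assms in \<open>auto simp: hcat_def\<close>)

text \<open>A kernel vector of \<open>B\<close>, padded with \<open>a\<close> leading zeros, is a
  kernel vector of the juxtaposition.\<close>

lemma hcat_inj_right:
  assumes A: "A \<in> carrier_mat d a" and B: "B \<in> carrier_mat d b"
    and inj: "\<And>x. x \<in> carrier_vec (a + b) \<Longrightarrow> hcat A B *\<^sub>v x = 0\<^sub>v d \<Longrightarrow> x = 0\<^sub>v (a + b)"
    and y: "y \<in> carrier_vec b" "B *\<^sub>v y = 0\<^sub>v d"
  shows "y = 0\<^sub>v b"
proof -
  have "hcat A B *\<^sub>v (0\<^sub>v a @\<^sub>v y) = A *\<^sub>v 0\<^sub>v a + B *\<^sub>v y"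
    by (rule hcat_mult_vec[OF A B _ y(1)]) simp
  also have "\<dots> = 0\<^sub>v d" using A y by (auto intro!: eq_vecI)
  finally have "0\<^sub>v a @\<^sub>v y = 0\<^sub>v (a + b)" using inj y(1) by simp
  then have "\<And>i. i < b \<Longrightarrow> (0\<^sub>v a @\<^sub>v y) $ (a + i) = 0" by simp
  then show ?thesis using y(1) by (auto intro!: eq_vecI)
qed

section \<open>Change of basis and positivity of Gram determinants\<close>

lemma scalar_prod_self_pos:
  fixes v :: "rat vec"
  assumes "v \<in> carrier_vec d" "v \<noteq> 0\<^sub>v d"
  shows "v \<bullet> v > 0"
proof -
  have nn: "v \<bullet> v \<ge> 0" by (auto simp: scalar_prod_def intro: sum_nonneg)
  have "v \<bullet> v \<noteq> 0"
  proof
    assume "v \<bullet> v = 0"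
    then have "\<forall>i\<in>{0..<dim_vec v}. v $ i * v $ i = 0"
      by (subst (asm) scalar_prod_def, subst (asm) sum_nonneg_eq_0_iff) auto
    then show False using assms by (auto intro!: eq_vecI)
  qed
  then show ?thesis using nn by simp
qed

lemma scalar_prod_transpose_mult_vec:
  fixes W :: "rat mat"
  assumes "W \<in> carrier_mat d r" "x \<in> carrier_vec d" "u \<in> carrier_vec r"
  shows "x \<bullet> (W *\<^sub>v u) = (W\<^sup>T *\<^sub>v x) \<bullet> u"
  using assms transpose_vec_mult_scalar[of W d r u x] by simp

lemma nonsingular_inverse:
  fixes G :: "rat mat"
  assumes G: "G \<in> carrier_mat n n" and nz: "det G \<noteq> 0"
  obtains G' where "G' \<in> carrier_mat n n" "G * G' = 1\<^sub>m n" "G' * G = 1\<^sub>m n"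
proof -
  from det_non_zero_imp_unit[OF G nz, of "()"]
  obtain G' where "G' \<in> carrier_mat n n" "G' * G = 1\<^sub>m n" "G * G' = 1\<^sub>m n"
    by (auto simp: Units_def ring_mat_def)
  then show ?thesis using that by blast
qed

text \<open>Since (BN)^T (BN) = N^T (B^T B) N, the factor \<open>det N\<close> enters twice. This
  serves for unitriangular and unimodular changes of basis, for the dual basis, and for the rational
  change of columns in \<open>orth_lattice\<close>.\<close>

lemma det_gram_mult:
  fixes B :: "rat mat"
  assumes B: "B \<in> carrier_mat d n" and N: "N \<in> carrier_mat n n"
  shows "det ((B * N)\<^sup>T * (B * N)) = (det N)\<^sup>2 * det (B\<^sup>T * B)"
proof -
  have "(B * N)\<^sup>T * (B * N) = N\<^sup>T * B\<^sup>T * (B * N)" using B N by (simp add: transpose_mult)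
  also have "\<dots> = N\<^sup>T * (B\<^sup>T * (B * N))" using B N by (intro assoc_mult_mat) auto
  also have "B\<^sup>T * (B * N) = (B\<^sup>T * B) * N" using B N by (intro assoc_mult_mat[symmetric]) auto
  also have "det (N\<^sup>T * \<dots>) = det (N\<^sup>T) * det (B\<^sup>T * B * N)"
    by (rule det_mult[of _ n]) (use B N in auto)
  also have "det (B\<^sup>T * B * N) = det (B\<^sup>T * B) * det N"
    by (rule det_mult[of _ n]) (use B N in auto)
  finally show ?thesis using N by (simp add: det_transpose power2_eq_square)
qed

lemma det_1x1: "A \<in> carrier_mat (Suc 0) (Suc 0) \<Longrightarrow> det (A :: rat mat) = A $$ (0, 0)"
  by (rule det_single) simp

text \<open>Gram-Schmidt by induction on the number of columns: replacing the first column by its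
  component \<open>w\<close> orthogonal to the others does not change the Gram determinant, which
  then splits as the squared length of \<open>w\<close> times the Gram determinant of the remaining
  columns.\<close>

lemma gram_det_pos:
  fixes B :: "rat mat"
  assumes B: "B \<in> carrier_mat d n"
    and inj: "\<And>x. x \<in> carrier_vec n \<Longrightarrow> B *\<^sub>v x = 0\<^sub>v d \<Longrightarrow> x = 0\<^sub>v n"
  shows "det (B\<^sup>T * B) > 0"
  using assms
proof (induction n arbitrary: B)
  case 0
  then have "det (B\<^sup>T * B) = 1" by (intro det_dim_zero) auto
  then show ?case by simp
next
  case (Suc n)
  have "B \<in> carrier_mat d (1 + n)" using Suc.prems(1) by simp
  then obtain b B2 where b: "b \<in> carrier_mat d 1" and B2: "B2 \<in> carrier_mat d n" and Bs: "B = hcat b B2"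
    by (rule hcat_split)
  have inj2: "y = 0\<^sub>v n" if "y \<in> carrier_vec n" "B2 *\<^sub>v y = 0\<^sub>v d" for y
    by (rule hcat_inj_right[OF b B2 _ that]) (use Suc.prems(2) Bs in auto)
  let ?G = "B2\<^sup>T * B2"
  have pos2: "det ?G > 0" by (rule Suc.IH[OF B2 inj2])
  have G: "?G \<in> carrier_mat n n" using B2 by simp
  obtain G' where G': "G' \<in> carrier_mat n n" "?G * G' = 1\<^sub>m n"
    using nonsingular_inverse[OF G] pos2 by (metis less_irrefl)
  \<comment> \<open>Project the first column onto the orthogonal complement of the others.\<close>
  define c where "c = G' * (B2\<^sup>T * b)"
  have c: "c \<in> carrier_mat n 1" using G' b B2 by (simp add: c_def)
  define w where "w = b - B2 * c"
  have w: "w \<in> carrier_mat d 1" unfolding w_def by (rule minus_carrier_mat[OF mult_carrier_mat[OF B2 c]])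
  have "B2\<^sup>T * (B2 * c) = ?G * c" using B2 c by (intro assoc_mult_mat[symmetric]) auto
  also have "\<dots> = (?G * G') * (B2\<^sup>T * b)"
    unfolding c_def using B2 b G' by (intro assoc_mult_mat[symmetric]) auto
  finally have "B2\<^sup>T * (B2 * c) = B2\<^sup>T * b" using G' B2 b by simp
  then have orth: "B2\<^sup>T * w = 0\<^sub>m n 1"
    unfolding w_def using B2 b c by (subst mult_minus_distrib_mat[of _ n d]) auto
  have orth': "w\<^sup>T * B2 = 0\<^sub>m 1 n"
  proof -
    have "w\<^sup>T * B2 = (B2\<^sup>T * w)\<^sup>T" using w B2 by (simp add: transpose_mult)
    then show ?thesis by (simp add: orth)
  qed
  \<comment> \<open>This unitriangular matrix subtracts the projection \<open>B2 * c\<close> from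
    the first column and keeps the other columns.\<close>
  define N where "N = four_block_mat (1\<^sub>m 1) (0\<^sub>m 1 n) (- c) (1\<^sub>m n)"
  have N: "N \<in> carrier_mat (Suc n) (Suc n)" using c by (auto simp: N_def)
  have "det N = det (1\<^sub>m 1 :: rat mat) * det (1\<^sub>m n :: rat mat)"
    unfolding N_def by (rule four_block_det_diag(1)) (use c in auto)
  then have dN: "det N = 1" by simp
  have K: "hcat w B2 = B * N"
  proof (rule mat_col_eqI)
    fix j assume "j < dim_col (B * N)"
    then have j: "j < 1 + n" using N by simp
    have BN: "col (B * N) j = B *\<^sub>v col N j" using N j Suc.prems by (intro col_mult2) auto
    show "col (hcat w B2) j = col (B * N) j"
    proof (cases "j = 0")
      case True
      have cN: "col N j = unit_vec 1 0 @\<^sub>v (- col c 0)"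
        unfolding N_def using True c by (auto intro!: eq_vecI simp: unit_vec_def)
      have "col (B * N) j = b *\<^sub>v unit_vec 1 0 + B2 *\<^sub>v (- col c 0)"
        unfolding BN cN unfolding Bs by (rule hcat_mult_vec[OF b B2]) (use c in auto)
      also have "b *\<^sub>v unit_vec 1 0 = col b 0" by (rule mat_mult_unit_vec[OF b]) simp
      also have "B2 *\<^sub>v (- col c 0) = - col (B2 * c) 0"
        using B2 c by (auto intro!: eq_vecI simp: scalar_prod_def sum_negf)
      finally have "col (B * N) j = col w 0"
        unfolding w_def using b B2 c by (auto intro!: eq_vecI)
      then show ?thesis using True j by (simp add: col_hcat[OF w B2])
    next
      case False
      have cN: "col N j = 0\<^sub>v 1 @\<^sub>v unit_vec n (j - 1)"
        unfolding N_def using False j c by (auto intro!: eq_vecI simp: unit_vec_def)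
      have "col (B * N) j = b *\<^sub>v 0\<^sub>v 1 + B2 *\<^sub>v unit_vec n (j - 1)"
        unfolding BN cN unfolding Bs by (rule hcat_mult_vec[OF b B2]) auto
      also have "B2 *\<^sub>v unit_vec n (j - 1) = col B2 (j - 1)" using False j
        by (intro mat_mult_unit_vec[OF B2]) auto
      also have "b *\<^sub>v 0\<^sub>v 1 + col B2 (j - 1) = col B2 (j - 1)"
        using b B2 False j by (auto intro!: eq_vecI)
      finally show ?thesis using False j by (simp add: col_hcat[OF w B2])
    qed
  qed (use w B2 N Suc.prems in \<open>auto simp: hcat_def\<close>)
  have "det (B\<^sup>T * B) = det ((hcat w B2)\<^sup>T * hcat w B2)"
    unfolding K det_gram_mult[OF Suc.prems(1) N] dN by simp
  also have "\<dots> = det (four_block_mat (w\<^sup>T * w) (w\<^sup>T * B2) (B2\<^sup>T * w) ?G)"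
    using transpose_hcat_mult[OF w B2 w B2] by simp
  also have "\<dots> = det (w\<^sup>T * w) * det ?G"
    by (rule four_block_det_diag(1)[OF _ G _ _ orth']) (use w B2 in auto)
  also have "det (w\<^sup>T * w) = col w 0 \<bullet> col w 0"
    using w det_1x1[of "w\<^sup>T * w"] by simp
  finally have eq: "det (B\<^sup>T * B) = (col w 0 \<bullet> col w 0) * det ?G" .
  \<comment> \<open>If \<open>w\<close> vanished, the first column of \<open>N\<close> would lie in
    the kernel of \<open>B\<close>, although its top entry is 1.\<close>
  have "col w 0 \<noteq> 0\<^sub>v d"
  proof
    assume z: "col w 0 = 0\<^sub>v d"
    have "B *\<^sub>v col N 0 = col (B * N) 0" using N Suc.prems by (intro col_mult2[symmetric]) auto
    also have "\<dots> = 0\<^sub>v d" unfolding K[symmetric] by (simp add: col_hcat[OF w B2] z)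
    finally have "col N 0 = 0\<^sub>v (Suc n)"
      by (intro Suc.prems(2)) (use N in \<open>simp_all add: carrier_dim_vec\<close>)
    then have "col N 0 $ 0 = 0" by simp
    then show False using c by (simp add: N_def)
  qed
  then show ?case unfolding eq using scalar_prod_self_pos[of "col w 0" d] pos2 w
    by (simp add: carrier_dim_vec)
qed

subsection \<open>Rank, determinant and dual\<close>

text \<open>The traces of UV and VU agree; here they are the rational numbers n and m.\<close>

lemma mutual_inverses_same_dim:
  fixes U :: "rat mat"
  assumes U: "U \<in> carrier_mat n m" and V: "V \<in> carrier_mat m n"
    and UV: "U * V = 1\<^sub>m n" and VU: "V * U = 1\<^sub>m m"
  shows "n = m"
proof -
  have "of_nat n = (\<Sum>i\<in>{0..<n}. (U * V) $$ (i, i))" by (simp add: UV)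
  also have "\<dots> = (\<Sum>i\<in>{0..<n}. \<Sum>j\<in>{0..<m}. U $$ (i, j) * V $$ (j, i))"
    using U V by (intro sum.cong refl) (simp add: scalar_prod_def)
  also have "\<dots> = (\<Sum>j\<in>{0..<m}. \<Sum>i\<in>{0..<n}. V $$ (j, i) * U $$ (i, j))"
    by (subst sum.swap) (simp add: mult.commute)
  also have "\<dots> = (\<Sum>j\<in>{0..<m}. (V * U) $$ (j, j))"
    using U V by (intro sum.cong refl) (simp add: scalar_prod_def)
  also have "\<dots> = of_nat m" by (simp add: VU)
  finally show ?thesis by simp
qed

lemma int_matI_cols: "(\<And>j. j < dim_col A \<Longrightarrow> int_vec (col A j)) \<Longrightarrow> int_mat A"
  by (auto simp: int_mat_def int_vec_def)

lemma basis_mat_factor: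
  assumes B: "basis_mat d n L B" and K: "K \<in> carrier_mat d m"
    and sub: "\<And>j. j < m \<Longrightarrow> col K j \<in> L"
  obtains U where "U \<in> carrier_mat n m" "int_mat U" "K = B * U"
proof (rule mat_factor_cols[OF basis_matD(1)[OF B] K, where P = int_vec])
  fix j assume "j < m"
  then show "\<exists>x\<in>carrier_vec n. int_vec x \<and> col K j = B *\<^sub>v x"
    using sub unfolding basis_matD(3)[OF B] by blast
next
  fix N assume "N \<in> carrier_mat n m" "K = B * N" "\<And>j. j < m \<Longrightarrow> int_vec (col N j)"
  then show thesis using that int_matI_cols[of N] by auto
qed

text \<open>Each basis is an integer combination of the other. Cancelling the injective matrices
  shows that the transition matrices \<open>U\<close> and \<open>V\<close> are mutually inverse;
  their determinants are integers with product 1, so \<open>det U\<close> is 1 or -1 and its square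
  drops out of the Gram determinant.\<close>

lemma basis_mat_unique:
  assumes B: "basis_mat d n L B" and B': "basis_mat d m L B'"
  shows "m = n" and "det (B'\<^sup>T * B') = det (B\<^sup>T * B)"
proof -
  have b: "B \<in> carrier_mat d n" and b': "B' \<in> carrier_mat d m"
    using basis_matD(1)[OF B] basis_matD(1)[OF B'] .
  obtain U where U: "U \<in> carrier_mat n m" "int_mat U" "B' = B * U"
    using basis_mat_factor[OF B b' col_mem_lattice[OF B']] by blast
  obtain V where V: "V \<in> carrier_mat m n" "int_mat V" "B = B' * V"
    using basis_mat_factor[OF B' b col_mem_lattice[OF B]] by blast
  have "B * (U * V) = B * U * V" by (rule assoc_mult_mat[OF b U(1) V(1), symmetric])
  also have "\<dots> = B * 1\<^sub>m n" using U(3) V(3) right_mult_one_mat[OF b] by metis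
  finally have UV: "U * V = 1\<^sub>m n"
    by - (rule mult_left_cancel_inj[OF b _ mult_carrier_mat[OF U(1) V(1)] one_carrier_mat], rule basis_matD(2)[OF B])
  have "B' * (V * U) = B' * V * U" by (rule assoc_mult_mat[OF b' V(1) U(1), symmetric])
  also have "\<dots> = B' * 1\<^sub>m m" using U(3) V(3) right_mult_one_mat[OF b'] by metis
  finally have VU: "V * U = 1\<^sub>m m"
    by - (rule mult_left_cancel_inj[OF b' _ mult_carrier_mat[OF V(1) U(1)] one_carrier_mat], rule basis_matD(2)[OF B'])
  show mn: "m = n" using mutual_inverses_same_dim[OF U(1) V(1) UV VU] by simp
  have "det U * det V = 1"
    using det_mult[of U n V] U V mn UV by simp
  moreover obtain u v where "det U = of_int u" "det V = of_int v"
    using int_mat_det U V mn by (metis Ints_cases)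
  ultimately have "u * v = 1" by (metis of_int_eq_1_iff of_int_mult)
  then have "u = 1 \<or> u = -1" by (rule pos_zmult_eq_1_iff_lemma)
  then have "(det U)\<^sup>2 = 1" using \<open>det U = of_int u\<close> by auto
  then show "det (B'\<^sup>T * B') = det (B\<^sup>T * B)"
    using det_gram_mult[OF b, of U] U mn by simp
qed

lemma basis_mat_lat_basis:
  assumes "is_lattice d L"
  shows "basis_mat d (lat_rank d L) L (mat_of_cols d (lat_basis d L))"
proof -
  have "is_basis d L (lat_basis d L)"
    using assms unfolding is_lattice_def lat_basis_def by (metis someI_ex)
  then show ?thesis unfolding lat_rank_def by (rule basis_mat_of_is_basis)
qed

text \<open>This fact and the next one make rank and determinant computable from any basis, not just
  the one picked by \<open>SOME\<close>.\<close>

lemma lat_rank_eq: "basis_mat d n L B \<Longrightarrow> lat_rank d L = n"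
  using basis_mat_unique(1) basis_mat_lat_basis is_latticeI by blast

lemma lat_det_eq: "basis_mat d n L B \<Longrightarrow> lat_det d L = sqrt (real_of_rat (det (B\<^sup>T * B)))"
  unfolding lat_det_def Let_def
  using basis_mat_unique(2)[OF _ basis_mat_lat_basis[OF is_latticeI]] by simp

lemma basis_mat_gram_pos: "basis_mat d n L B \<Longrightarrow> det (B\<^sup>T * B) > 0"
  using gram_det_pos basis_matD by blast

lemma lat_det_pos: "is_lattice d L \<Longrightarrow> lat_det d L > 0"
  using basis_mat_gram_pos[OF basis_mat_lat_basis] lat_det_eq[OF basis_mat_lat_basis] by simp

lemma int_vec_scalar_prod: "int_vec v \<Longrightarrow> int_vec u \<Longrightarrow> dim_vec v = dim_vec u \<Longrightarrow> v \<bullet> u \<in> \<int>"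
  by (auto simp: int_vec_def scalar_prod_def intro!: Ints_sum Ints_mult)

text \<open>The entries of B^T w are the pairings of w with the basis vectors, and integrality on a
  basis extends to all integer combinations.\<close>

lemma mem_dual_lat_iff:
  assumes B: "basis_mat d n L B"
  shows "w \<in> dual_lat d L \<longleftrightarrow> w \<in> qspan d L \<and> int_vec (B\<^sup>T *\<^sub>v w)"
proof -
  have b: "B \<in> carrier_mat d n" by (rule basis_matD(1)[OF B])
  have "(\<forall>y\<in>L. w \<bullet> y \<in> \<int>) \<longleftrightarrow> int_vec (B\<^sup>T *\<^sub>v w)" if "w \<in> qspan d L"
  proof -
    have w: "w \<in> carrier_vec d" using that b by (auto simp: qspan_basis_mat[OF B])
    show ?thesis
    proof
      assume l: "\<forall>y\<in>L. w \<bullet> y \<in> \<int>"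
      have "(B\<^sup>T *\<^sub>v w) $ i \<in> \<int>" if "i < n" for i
        using l col_mem_lattice[OF B that] b w that by (simp add: comm_scalar_prod[of _ d])
      then show "int_vec (B\<^sup>T *\<^sub>v w)" using b by (simp add: int_vec_def)
    next
      assume r: "int_vec (B\<^sup>T *\<^sub>v w)"
      show "\<forall>y\<in>L. w \<bullet> y \<in> \<int>"
      proof
        fix y assume "y \<in> L"
        then obtain x where x: "x \<in> carrier_vec n" "int_vec x" "y = B *\<^sub>v x"
          unfolding basis_matD(3)[OF B] by blast
        then show "w \<bullet> y \<in> \<int>"
          using scalar_prod_transpose_mult_vec[OF b w x(1)] int_vec_scalar_prod[OF r x(2)] b by simp
      qed
    qed
  qed
  then show ?thesis by (auto simp: dual_lat_def)
qed

text \<open>With G' the inverse of the Gram matrix, B^T (B G') is the identity. Hence the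
  coordinates of a vector w of the span with respect to B G' are exactly the pairings B^T w.\<close>

lemma basis_mat_dual:
  assumes B: "basis_mat d n L B"
    and G': "G' \<in> carrier_mat n n" "B\<^sup>T * B * G' = 1\<^sub>m n" "G' * (B\<^sup>T * B) = 1\<^sub>m n"
  shows "basis_mat d n (dual_lat d L) (B * G')"
proof -
  have b: "B \<in> carrier_mat d n" by (rule basis_matD(1)[OF B])
  have G: "B\<^sup>T * B \<in> carrier_mat n n" using b by simp
  have DG: "B *\<^sub>v (G' *\<^sub>v z) = B * G' *\<^sub>v z" if "z \<in> carrier_vec n" for z
    using b G'(1) that by (rule assoc_mult_mat_vec[symmetric])
  have GG: "B\<^sup>T *\<^sub>v (B *\<^sub>v (G' *\<^sub>v z)) = z" if z: "z \<in> carrier_vec n" for z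
  proof -
    have "B\<^sup>T *\<^sub>v (B *\<^sub>v (G' *\<^sub>v z)) = B\<^sup>T * B *\<^sub>v (G' *\<^sub>v z)"
      using b G' z by (intro assoc_mult_mat_vec[symmetric, of _ n d _ n]) auto
    also have "\<dots> = B\<^sup>T * B * G' *\<^sub>v z" using G G' z by (intro assoc_mult_mat_vec[symmetric]) auto
    finally show ?thesis using G'(2) z by simp
  qed
  have GG': "G' *\<^sub>v (B\<^sup>T *\<^sub>v (B *\<^sub>v x)) = x" if x: "x \<in> carrier_vec n" for x
  proof -
    have "B\<^sup>T *\<^sub>v (B *\<^sub>v x) = B\<^sup>T * B *\<^sub>v x"
      using b x by (intro assoc_mult_mat_vec[symmetric, of _ n d _ n]) auto
    then have "G' *\<^sub>v (B\<^sup>T *\<^sub>v (B *\<^sub>v x)) = G' * (B\<^sup>T * B) *\<^sub>v x"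
      using assoc_mult_mat_vec[OF G'(1) G x] by simp
    then show ?thesis unfolding G'(3) using x by simp
  qed
  show ?thesis unfolding basis_mat_def
  proof (intro conjI ballI impI)
    show "B * G' \<in> carrier_mat d n" using b G' by simp
  next
    fix z :: "rat vec" assume z: "z \<in> carrier_vec n" "B * G' *\<^sub>v z = 0\<^sub>v d"
    then have "B *\<^sub>v (G' *\<^sub>v z) = 0\<^sub>v d" using DG by simp
    then have "z = B\<^sup>T *\<^sub>v 0\<^sub>v d" using GG[OF z(1)] by simp
    also have "\<dots> = 0\<^sub>v n" using b by (auto intro!: eq_vecI)
    finally show "z = 0\<^sub>v n" .
  next
    show "dual_lat d L = {B * G' *\<^sub>v z |z. z \<in> carrier_vec n \<and> int_vec z}"
    proof (intro equalityI subsetI)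
      fix w assume "w \<in> dual_lat d L"
      then obtain x where x: "x \<in> carrier_vec n" "w = B *\<^sub>v x" "int_vec (B\<^sup>T *\<^sub>v w)"
        unfolding mem_dual_lat_iff[OF B] qspan_basis_mat[OF B] by blast
      have z: "B\<^sup>T *\<^sub>v w \<in> carrier_vec n" using b x by simp
      have "B * G' *\<^sub>v (B\<^sup>T *\<^sub>v w) = w" using DG[OF z] GG'[OF x(1)] x by simp
      then show "w \<in> {B * G' *\<^sub>v z |z. z \<in> carrier_vec n \<and> int_vec z}" using z x(3) by (metis (mono_tags, lifting) mem_Collect_eq)
    next
      fix w assume "w \<in> {B * G' *\<^sub>v z |z. z \<in> carrier_vec n \<and> int_vec z}"
      then obtain z where z: "z \<in> carrier_vec n" "int_vec z" "w = B *\<^sub>v (G' *\<^sub>v z)"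
        using DG by auto
      have "G' *\<^sub>v z \<in> carrier_vec n" using G' z by simp
      then show "w \<in> dual_lat d L"
        unfolding mem_dual_lat_iff[OF B] qspan_basis_mat[OF B] using z GG[OF z(1)] by auto
    qed
  qed
qed

text \<open>The Gram determinant of B G' is (det G')^2 det(B^T B), and det G' is the reciprocal of
  det(B^T B).\<close>

lemma dual_lattice:
  assumes L: "is_lattice d L"
  shows "is_lattice d (dual_lat d L)" and "lat_rank d (dual_lat d L) = lat_rank d L"
    and "lat_det d (dual_lat d L) = 1 / lat_det d L"
proof -
  define n where "n = lat_rank d L"
  define B where "B = mat_of_cols d (lat_basis d L)"
  have B: "basis_mat d n L B" unfolding n_def B_def by (rule basis_mat_lat_basis[OF L])
  have b: "B \<in> carrier_mat d n" by (rule basis_matD(1)[OF B])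
  have G: "B\<^sup>T * B \<in> carrier_mat n n" using b by simp
  have pos: "det (B\<^sup>T * B) > 0" by (rule basis_mat_gram_pos[OF B])
  obtain G' where G': "G' \<in> carrier_mat n n" "B\<^sup>T * B * G' = 1\<^sub>m n" "G' * (B\<^sup>T * B) = 1\<^sub>m n"
    using nonsingular_inverse[OF G] pos by (metis less_irrefl)
  note D = basis_mat_dual[OF B G']
  show "is_lattice d (dual_lat d L)" by (rule is_latticeI[OF D])
  show "lat_rank d (dual_lat d L) = lat_rank d L" using lat_rank_eq[OF D] by (simp add: n_def)
  have "det (B\<^sup>T * B) * det G' = 1" using det_mult[OF G G'(1)] G'(2) by simp
  then have "det ((B * G')\<^sup>T * (B * G')) = 1 / det (B\<^sup>T * B)"
    unfolding det_gram_mult[OF b G'(1)] using pos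
    by (simp add: field_simps power2_eq_square)
  then show "lat_det d (dual_lat d L) = 1 / lat_det d L"
    unfolding lat_det_eq[OF D] lat_det_eq[OF B] by (simp add: real_sqrt_divide of_rat_divide)
qed

subsection \<open>Intersection with an orthogonal complement\<close>

text \<open>As \<open>E\<close> and its inverse \<open>F\<close> are both integral, x \<mapsto> Ex
  is a bijection of the integer vectors.\<close>

lemma basis_mat_unimodular:
  assumes B: "basis_mat d n L B"
    and E: "E \<in> carrier_mat n n" "int_mat E" and F: "F \<in> carrier_mat n n" "int_mat F"
    and EF: "E * F = 1\<^sub>m n" and FE: "F * E = 1\<^sub>m n"
  shows "basis_mat d n L (B * E)"
proof -
  have b: "B \<in> carrier_mat d n" by (rule basis_matD(1)[OF B])
  have BE: "B * E *\<^sub>v x = B *\<^sub>v (E *\<^sub>v x)" if "x \<in> carrier_vec n" for x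
    by (rule assoc_mult_mat_vec[OF b E(1) that])
  have FEx: "F *\<^sub>v (E *\<^sub>v x) = x" if "x \<in> carrier_vec n" for x
    using assoc_mult_mat_vec[OF F(1) E(1) that] FE that by simp
  have EFx: "E *\<^sub>v (F *\<^sub>v x) = x" if "x \<in> carrier_vec n" for x
    using assoc_mult_mat_vec[OF E(1) F(1) that] EF that by simp
  have Ec: "E *\<^sub>v x \<in> carrier_vec n" and Fc: "F *\<^sub>v x \<in> carrier_vec n" if "x \<in> carrier_vec n" for x
    using E(1) F(1) that by auto
  show ?thesis unfolding basis_mat_def
  proof (intro conjI ballI impI)
    show "B * E \<in> carrier_mat d n" using b E by simp
  next
    fix x :: "rat vec" assume x: "x \<in> carrier_vec n" "B * E *\<^sub>v x = 0\<^sub>v d"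
    then have "E *\<^sub>v x = 0\<^sub>v n" using BE basis_matD(2)[OF B Ec] by simp
    then have "x = F *\<^sub>v 0\<^sub>v n" using FEx[OF x(1)] by simp
    also have "\<dots> = 0\<^sub>v n" using F(1) by (auto intro!: eq_vecI)
    finally show "x = 0\<^sub>v n" .
  next
    show "L = {B * E *\<^sub>v x |x. x \<in> carrier_vec n \<and> int_vec x}"
    proof (intro equalityI subsetI)
      fix y assume "y \<in> L"
      then obtain x where x: "x \<in> carrier_vec n" "int_vec x" "y = B *\<^sub>v x"
        unfolding basis_matD(3)[OF B] by blast
      then have "y = B * E *\<^sub>v (F *\<^sub>v x)" using BE[OF Fc] EFx by simp
      moreover have "int_vec (F *\<^sub>v x)" using int_mat_mult_vec[OF F(2) x(2)] x(1) F(1) by simp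
      ultimately show "y \<in> {B * E *\<^sub>v x |x. x \<in> carrier_vec n \<and> int_vec x}" using Fc[OF x(1)] by blast
    next
      fix y assume "y \<in> {B * E *\<^sub>v x |x. x \<in> carrier_vec n \<and> int_vec x}"
      then obtain x where x: "x \<in> carrier_vec n" "int_vec x" "y = B *\<^sub>v (E *\<^sub>v x)"
        using BE by auto
      moreover have "int_vec (E *\<^sub>v x)" using int_mat_mult_vec[OF E(2) x(2)] x(1) E(1) by simp
      ultimately show "y \<in> L" unfolding basis_matD(3)[OF B] using Ec[OF x(1)] by blast
    qed
  qed
qed

section \<open>Triangularisation by integer column operations\<close>

lemma basis_mat_addcol:
  assumes B: "basis_mat d n L B" and kl: "k < n" "l < n" "k \<noteq> l" and a: "a \<in> \<int>"
  shows "basis_mat d n L (addcol a k l B)"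
proof -
  have "addcol a k l B = B * addrow_mat n a l k"
    by (rule addcol_mat[OF basis_matD(1)[OF B] kl(2)])
  moreover have "basis_mat d n L (B * addrow_mat n a l k)"
  proof (rule basis_mat_unimodular[OF B])
    show "addrow_mat n a l k * addrow_mat n (- a) l k = 1\<^sub>m n"
      using addrow_mat_inv[of l n k a] kl by auto
    show "addrow_mat n (- a) l k * addrow_mat n a l k = 1\<^sub>m n"
      using addrow_mat_inv[of l n k "- a"] kl by auto
  qed (use a in \<open>auto simp: int_mat_def\<close>)
  ultimately show ?thesis by simp
qed

lemma scalar_prod_col_addcol:
  fixes B :: "rat mat"
  assumes "B \<in> carrier_mat d n" "w \<in> carrier_vec d" "k < n" "l < n" "j < n"
  shows "w \<bullet> col (addcol a k l B) j = (if j = k then a * (w \<bullet> col B l) + w \<bullet> col B k else w \<bullet> col B j)"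
proof (cases "j = k")
  case True
  have c: "col B l \<in> carrier_vec d" "col B k \<in> carrier_vec d" using assms by auto
  show ?thesis
    using True assms c by (simp add: scalar_prod_add_distrib[of w d])
next
  case False
  have "col (addcol a k l B) j = col B j" using assms False by (auto intro!: eq_vecI)
  then show ?thesis using False by simp
qed

text \<open>One step of the subtractive Euclidean algorithm. Sizes are expressed as natural numbers
  so that they can be summed into a measure with a minimum.\<close>

lemma abs_int_sub_less:
  fixes x y :: rat
  assumes "x \<in> \<int>" "y \<in> \<int>" "x \<noteq> 0" "y \<noteq> 0" "\<bar>y\<bar> \<le> \<bar>x\<bar>"
  obtains a :: rat where "a \<in> \<int>" "nat \<lfloor>\<bar>a * y + x\<bar>\<rfloor> < nat \<lfloor>\<bar>x\<bar>\<rfloor>"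
proof -
  obtain u v where uv: "x = of_int u" "y = of_int v" using assms by (auto elim!: Ints_cases)
  \<comment> \<open>The sign makes \<open>a * v\<close> opposite to \<open>u\<close>, so the
    absolute value drops by that of \<open>v\<close>.\<close>
  define a where "a = (if (u > 0) = (v > 0) then -1 else 1 :: int)"
  have "\<bar>a * v + u\<bar> < \<bar>u\<bar>" using assms unfolding uv a_def by (auto split: if_splits)
  moreover have "nat \<lfloor>\<bar>of_int a * y + x\<bar>\<rfloor> = nat \<bar>a * v + u\<bar>"
    unfolding uv by (metis floor_of_int of_int_abs of_int_add of_int_mult)
  moreover have "nat \<lfloor>\<bar>x\<bar>\<rfloor> = nat \<bar>u\<bar>" unfolding uv by (metis floor_of_int of_int_abs)
  ultimately show ?thesis using that[of "of_int a"] assms(3) uv(1) by simp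
qed

text \<open>Hermite-style reduction of the integer matrix with entries
  \<open>w i \<bullet> col B j\<close>, one row per induction step. Operations among columns of
  index at least \<open>s\<close> keep the rows before \<open>s\<close>, where all these columns
  already have zeros.\<close>

lemma triangular_basis:
  assumes B0: "basis_mat d n L B0" and W: "\<And>i. i < r \<Longrightarrow> w i \<in> carrier_vec d"
    and int: "\<And>i y. i < r \<Longrightarrow> y \<in> L \<Longrightarrow> w i \<bullet> y \<in> \<int>"
  shows "s \<le> r \<Longrightarrow> s \<le> n \<Longrightarrow>
    \<exists>B. basis_mat d n L B \<and> (\<forall>i<s. \<forall>j<n. i < j \<longrightarrow> w i \<bullet> col B j = 0)"
proof (induction s)
  case 0
  then show ?case using B0 by auto
next
  case (Suc s)
  define P where "P B \<longleftrightarrow> basis_mat d n L B \<and> (\<forall>i<s. \<forall>j<n. i < j \<longrightarrow> w i \<bullet> col B j = 0)" for B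
  \<comment> \<open>The l1-norm of the part of row \<open>s\<close> still to be cleared. For bases
    of \<open>L\<close> the entries are integers, so the floors lose nothing.\<close>
  define m where "m B = (\<Sum>j\<in>{s..<n}. nat \<lfloor>\<bar>w s \<bullet> col B j\<bar>\<rfloor>)" for B
  have s: "s < r" "s < n" using Suc by auto
  have P_addcol: "P (addcol a k l B)" if "P B" "a \<in> \<int>" "k \<noteq> l" "s \<le> k" "k < n" "s \<le> l" "l < n" for a k l B
    unfolding P_def
  proof (intro conjI allI impI)
    have B: "basis_mat d n L B" using that by (simp add: P_def)
    show "basis_mat d n L (addcol a k l B)" by (rule basis_mat_addcol[OF B]) (use that in auto)
    fix i j assume ij: "i < s" "j < n" "i < j"
    have "\<And>j. j < n \<Longrightarrow> i < j \<Longrightarrow> w i \<bullet> col B j = 0" using that(1) ij by (simp add: P_def)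
    then show "w i \<bullet> col (addcol a k l B) j = 0"
      using scalar_prod_col_addcol[OF basis_matD(1)[OF B] W, of i k l j a] ij that s by auto
  qed
  \<comment> \<open>A basis minimising row \<open>s\<close> from column \<open>s\<close> on has at most one nonzero entry there.\<close>
  have "\<exists>B. P B" using Suc unfolding P_def by auto
  then obtain B where PB: "P B" and least: "\<And>B'. P B' \<Longrightarrow> m B \<le> m B'"
    using ex_has_least_nat[of P _ m] by metis
  have B: "basis_mat d n L B" using PB by (simp add: P_def)
  have b: "B \<in> carrier_mat d n" by (rule basis_matD(1)[OF B])
  define f where "f j = w s \<bullet> col B j" for j
  have fint: "f j \<in> \<int>" if "j < n" for j
    unfolding f_def using int[OF s(1) col_mem_lattice[OF B that]] .
  have col_f: "w s \<bullet> col (addcol a k l B) j = (if j = k then a * f l + f k else f j)"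
    if "k < n" "l < n" "j < n" for a k l j
    unfolding f_def by (rule scalar_prod_col_addcol[OF b W[OF s(1)] that])
  \<comment> \<open>With two nonzero entries, a Euclidean step on the larger one would lower
    \<open>m\<close> while preserving \<open>P\<close>.\<close>
  have one_aux: False if kl: "s \<le> k" "k < n" "s \<le> l" "l < n" "k \<noteq> l" "f k \<noteq> 0" "f l \<noteq> 0" "\<bar>f l\<bar> \<le> \<bar>f k\<bar>" for k l
  proof -
    obtain a :: rat where a: "a \<in> \<int>" "nat \<lfloor>\<bar>a * f l + f k\<bar>\<rfloor> < nat \<lfloor>\<bar>f k\<bar>\<rfloor>"
      using abs_int_sub_less[of "f k" "f l"] fint kl by blast
    have "m (addcol a k l B) < m B" unfolding m_def
    proof (rule sum_strict_mono_ex1)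
      show "\<forall>j\<in>{s..<n}. nat \<lfloor>\<bar>w s \<bullet> col (addcol a k l B) j\<bar>\<rfloor> \<le> nat \<lfloor>\<bar>w s \<bullet> col B j\<bar>\<rfloor>"
        using a kl by (auto simp: col_f f_def[symmetric] less_imp_le simp del: col_addcol)
      show "\<exists>j\<in>{s..<n}. nat \<lfloor>\<bar>w s \<bullet> col (addcol a k l B) j\<bar>\<rfloor> < nat \<lfloor>\<bar>w s \<bullet> col B j\<bar>\<rfloor>"
        using a kl by (auto simp: col_f f_def[symmetric] simp del: col_addcol intro!: bexI[of _ k])
    qed simp
    moreover have "P (addcol a k l B)" using P_addcol[OF PB a(1)] kl by auto
    ultimately show False using least by (meson not_less)
  qed
  have one: "f k = 0 \<or> f l = 0" if "s \<le> k" "k < n" "s \<le> l" "l < n" "k \<noteq> l" for k l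
    using one_aux[of k l] one_aux[of l k] that by (metis linear)
  have fin: ?case if "P B'" "\<And>j. s < j \<Longrightarrow> j < n \<Longrightarrow> w s \<bullet> col B' j = 0" for B'
  proof (intro exI[of _ B'] conjI allI impI)
    show "basis_mat d n L B'" using that(1) by (simp add: P_def)
    fix i j assume "i < Suc s" "j < n" "i < j"
    then show "w i \<bullet> col B' j = 0" using that unfolding P_def by (cases "i = s") auto
  qed
  show ?case
  proof (cases "\<exists>k>s. k < n \<and> f k \<noteq> 0")
    case False
    then show ?thesis by (intro fin[OF PB]) (auto simp: f_def)
  next
    case True
    then obtain k where k: "s < k" "k < n" "f k \<noteq> 0" by blast
    have z: "f j = 0" if "s \<le> j" "j < n" "j \<noteq> k" for j using one[of j k] k that by auto
    \<comment> \<open>The only nonzero entry sits in column \<open>k\<close> beyond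
      \<open>s\<close>. Adding column \<open>k\<close> to column \<open>s\<close> copies it there,
      and subtracting column \<open>s\<close> from column \<open>k\<close> then clears it, so no
      swap is required.\<close>
    let ?B1 = "addcol 1 s k B"
    have P1: "P ?B1" using P_addcol[OF PB, of 1 s k] k s by auto
    have P2: "P (addcol (-1) k s ?B1)" using P_addcol[OF P1, of "-1" k s] k s by auto
    show ?thesis
    proof (rule fin[OF P2])
      fix j assume j: "s < j" "j < n"
      have c1: "?B1 \<in> carrier_mat d n" using b by auto
      have fs: "f s = 0" using z[OF order.refl s(2)] k(1) by blast
      have f1: "w s \<bullet> col ?B1 s = f k" "w s \<bullet> col ?B1 k = f k"
        unfolding col_f[OF s(2) k(2) s(2)] col_f[OF s(2) k(2) k(2)] using fs k(1) by auto
      have f2: "w s \<bullet> col ?B1 j = 0" if "j \<noteq> k"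
        unfolding col_f[OF s(2) k(2) j(2)] using that z[OF less_imp_le[OF j(1)] j(2)] j(1) by auto
      show "w s \<bullet> col (addcol (-1) k s ?B1) j = 0"
        unfolding scalar_prod_col_addcol[OF c1 W[OF s(1)] k(2) s(2) j(2)] using f1 f2 by (cases "j = k") auto
    qed
  qed
qed

text \<open>The inclusion of \<open>M\<close> in the dual makes the pairing matrix \<open>H\<close>
  integral. Once \<open>H\<close> is known to be nonsingular, the square of its determinant is at
  least 1, and the determinant identity becomes the inequality.\<close>

lemma orth_lattice:
  assumes L: "is_lattice d L" and M: "is_lattice d M" and sub: "M \<subseteq> dual_lat d L"
    and le: "lat_rank d M \<le> lat_rank d L"
  shows "is_lattice d (L \<inter> orth d M)"
    and "lat_rank d (L \<inter> orth d M) = lat_rank d L - lat_rank d M"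
    and "lat_det d (L \<inter> orth d M) \<le> lat_det d L * lat_det d M"
proof -
  define r where "r = lat_rank d M"
  define q where "q = lat_rank d L - r"
  have rq: "lat_rank d L = r + q" using le by (simp add: r_def q_def)
  define W where "W = mat_of_cols d (lat_basis d M)"
  have WM: "basis_mat d r M W" unfolding r_def W_def by (rule basis_mat_lat_basis[OF M])
  have w: "W \<in> carrier_mat d r" by (rule basis_matD(1)[OF WM])
  have colw: "col W i \<in> carrier_vec d" for i using w by (simp add: carrier_dim_vec)
  have colM: "col W i \<in> dual_lat d L" if "i < r" for i using col_mem_lattice[OF WM that] sub by blast
  have int: "col W i \<bullet> y \<in> \<int>" if "i < r" "y \<in> L" for i y
    using colM[OF that(1)] that(2) by (simp add: dual_lat_def)
  obtain B where B: "basis_mat d (r + q) L B"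
    and tri: "\<And>i j. i < r \<Longrightarrow> j < r + q \<Longrightarrow> i < j \<Longrightarrow> col W i \<bullet> col B j = 0"
    using triangular_basis[OF basis_mat_lat_basis[OF L, unfolded rq], of r "col W" r] colw int by auto
  have b: "B \<in> carrier_mat d (r + q)" by (rule basis_matD(1)[OF B])
  obtain B1 B2 where b1: "B1 \<in> carrier_mat d r" and b2: "B2 \<in> carrier_mat d q" and Bs: "B = hcat B1 B2"
    using hcat_split[OF b] .
  have inj2: "y = 0\<^sub>v q" if "y \<in> carrier_vec q" "B2 *\<^sub>v y = 0\<^sub>v d" for y
    by (rule hcat_inj_right[OF b1 b2 _ that]) (use basis_matD(2)[OF B] Bs in auto)
  \<comment> \<open>The columns of \<open>B2\<close> have index at least \<open>r\<close> in
    \<open>B\<close>, hence beyond the diagonal in each of the \<open>r\<close> rows.\<close>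
  have WB2: "W\<^sup>T * B2 = 0\<^sub>m r q"
  proof (rule eq_matI)
    fix i j assume "i < dim_row (0\<^sub>m r q :: rat mat)" "j < dim_col (0\<^sub>m r q :: rat mat)"
    then have ij: "i < r" "j < q" by auto
    then have "col W i \<bullet> col B (r + j) = 0" by (intro tri) auto
    then show "(W\<^sup>T * B2) $$ (i, j) = 0\<^sub>m r q $$ (i, j)"
      using ij w b2 by (simp add: Bs col_hcat[OF b1 b2])
  qed (use w b2 in auto)
  have B2W: "B2\<^sup>T * W = 0\<^sub>m q r"
  proof -
    have "B2\<^sup>T * W = (W\<^sup>T * B2)\<^sup>T" using w b2 by (simp add: transpose_mult)
    then show ?thesis by (simp add: WB2)
  qed
  define H where "H = W\<^sup>T * B1"
  have H: "H \<in> carrier_mat r r" using w b1 by (simp add: H_def)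
  have Hint: "int_mat H"
    unfolding int_mat_def
  proof (intro allI impI)
    fix i j assume "i < dim_row H" "j < dim_col H"
    then have ij: "i < r" "j < r" using H by auto
    then have "H $$ (i, j) = col W i \<bullet> col B j"
      using w b1 by (simp add: H_def Bs col_hcat[OF b1 b2])
    then show "H $$ (i, j) \<in> \<int>" using int col_mem_lattice[OF B] ij by simp
  qed
  have HT: "B1\<^sup>T * W = H\<^sup>T" using w b1 by (simp add: H_def transpose_mult)

  let ?G = "B\<^sup>T * B" and ?D = "B2\<^sup>T * B2" and ?m = "W\<^sup>T * W"
  define K where "K = hcat W B2"
  have K: "K \<in> carrier_mat d (r + q)" using w b2 by (simp add: K_def)
  \<comment> \<open>Vectors of the dual lie in the rational span of \<open>L\<close>, so only a
    rational \<open>N\<close> is asked for.\<close>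
  obtain N where N: "N \<in> carrier_mat (r + q) (r + q)" and KN: "K = B * N"
  proof (rule mat_factor_cols[OF b K, where P = "\<lambda>_. True"])
    fix j assume j: "j < r + q"
    show "\<exists>x\<in>carrier_vec (r + q). True \<and> col K j = B *\<^sub>v x"
    proof (cases "j < r")
      case True
      then have "col K j \<in> qspan d L"
        using colM[OF True] by (simp add: K_def col_hcat[OF w b2] dual_lat_def)
      then show ?thesis by (auto simp: qspan_basis_mat[OF B])
    next
      case False
      then have "col K j = col B j" using j by (simp add: K_def Bs col_hcat[OF w b2] col_hcat[OF b1 b2])
      then show ?thesis using mat_mult_unit_vec[OF b j] by (intro bexI[of _ "unit_vec (r + q) j"]) auto
    qed
  qed blast
  \<comment> \<open>\<open>W\<close> and \<open>B2\<close> are orthogonal, so this matrix is block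
    diagonal; it gives one equation for \<open>det N\<close>.\<close>
  have "K\<^sup>T * K = four_block_mat ?m (W\<^sup>T * B2) (B2\<^sup>T * W) ?D"
    unfolding K_def by (rule transpose_hcat_mult[OF w b2 w b2])
  then have "det (K\<^sup>T * K) = det ?m * det ?D"
    using four_block_det_diag(1)[of ?m r ?D q "B2\<^sup>T * W" "W\<^sup>T * B2"] w b2 WB2 by simp
  then have e1: "det ?m * det ?D = (det N)\<^sup>2 * det ?G"
    using det_gram_mult[OF b N] KN by simp
  \<comment> \<open>A second equation for \<open>det N\<close>, from a block triangular matrix that
    also equals \<open>?G * N\<close>.\<close>
  have "B\<^sup>T * K = four_block_mat (H\<^sup>T) (B1\<^sup>T * B2) (B2\<^sup>T * W) ?D"
    unfolding K_def Bs HT[symmetric] by (rule transpose_hcat_mult[OF b1 b2 w b2])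
  then have "det (B\<^sup>T * K) = det (H\<^sup>T) * det ?D"
    using four_block_det_diag(2)[of "H\<^sup>T" r ?D q "B2\<^sup>T * W" "B1\<^sup>T * B2"] H b1 w b2 B2W by simp
  moreover have "B\<^sup>T * K = ?G * N"
    unfolding KN using b N by (intro assoc_mult_mat[symmetric]) auto
  moreover have "det (?G * N) = det ?G * det N" by (rule det_mult[of _ "r + q"]) (use b N in auto)
  ultimately have e2: "det H * det ?D = det ?G * det N" using det_transpose[OF H] by simp

  have pos: "det ?m > 0" "det ?G > 0" "det ?D > 0"
    using basis_mat_gram_pos[OF WM] basis_mat_gram_pos[OF B] gram_det_pos[OF b2 inj2] by auto
  have Hnz: "det H \<noteq> 0"
  proof
    assume "det H = 0"
    then have "det N = 0" using e2 pos by simp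
    then show False using e1 pos by simp
  qed
  \<comment> \<open>Eliminating \<open>det N\<close> from \<open>e1\<close> and
    \<open>e2\<close>.\<close>
  have "(det H)\<^sup>2 * det ?D * det ?D = (det H * det ?D)\<^sup>2" by (simp add: power2_eq_square)
  also have "\<dots> = det ?G * ((det N)\<^sup>2 * det ?G)" unfolding e2 by (simp add: power2_eq_square)
  also have "\<dots> = det ?G * det ?m * det ?D" unfolding e1[symmetric] by simp
  finally have e3: "(det H)\<^sup>2 * det ?D = det ?G * det ?m" using pos by simp
  obtain h where h: "det H = of_int h" using int_mat_det[OF Hint H] by (auto elim: Ints_cases)
  then have "h \<noteq> 0" using Hnz by auto
  then have "1 \<le> h\<^sup>2" by (simp add: int_one_le_iff_zero_less)
  then have "1 \<le> (det H)\<^sup>2" unfolding h by (metis of_int_1_le_iff of_int_power)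
  then have "1 * det ?D \<le> (det H)\<^sup>2 * det ?D" using pos by (intro mult_right_mono) auto
  then have le_det: "det ?D \<le> det ?G * det ?m" using e3 by simp

  have orth_iff: "x \<in> orth d M \<longleftrightarrow> W\<^sup>T *\<^sub>v x = 0\<^sub>v r" if x: "x \<in> carrier_vec d" for x
  proof
    assume o: "x \<in> orth d M"
    have "(W\<^sup>T *\<^sub>v x) $ i = 0" if "i < r" for i
      using o col_mem_lattice[OF WM that] w x that by (simp add: orth_def comm_scalar_prod[of _ d])
    then show "W\<^sup>T *\<^sub>v x = 0\<^sub>v r" using w by (intro eq_vecI) auto
  next
    assume z: "W\<^sup>T *\<^sub>v x = 0\<^sub>v r"
    have "x \<bullet> m = 0" if m: "m \<in> M" for m
    proof -
      obtain u where u: "u \<in> carrier_vec r" "m = W *\<^sub>v u"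
        using m unfolding basis_matD(3)[OF WM] by blast
      then show ?thesis using scalar_prod_transpose_mult_vec[OF w x u(1)] z by simp
    qed
    then show "x \<in> orth d M" using x by (simp add: orth_def)
  qed
  have WB: "W\<^sup>T *\<^sub>v (B1 *\<^sub>v y + B2 *\<^sub>v z) = H *\<^sub>v y"
    if y: "y \<in> carrier_vec r" and z: "z \<in> carrier_vec q" for y z
  proof -
    have wt: "W\<^sup>T \<in> carrier_mat r d" using w by simp
    have "W\<^sup>T *\<^sub>v (B1 *\<^sub>v y + B2 *\<^sub>v z) = W\<^sup>T *\<^sub>v (B1 *\<^sub>v y) + W\<^sup>T *\<^sub>v (B2 *\<^sub>v z)"
      using b1 b2 y z by (intro mult_add_distrib_mat_vec[OF wt]) auto
    also have "W\<^sup>T *\<^sub>v (B1 *\<^sub>v y) = H *\<^sub>v y"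
      unfolding H_def by (rule assoc_mult_mat_vec[OF wt b1 y, symmetric])
    also have "W\<^sup>T *\<^sub>v (B2 *\<^sub>v z) = 0\<^sub>m r q *\<^sub>v z"
      unfolding WB2[symmetric] by (rule assoc_mult_mat_vec[OF wt b2 z, symmetric])
    also have "\<dots> = 0\<^sub>v r" using z by (auto intro!: eq_vecI)
    finally show ?thesis using right_zero_vec[OF mult_mat_vec_carrier[OF H y]] by simp
  qed
  have basis2: "basis_mat d q (L \<inter> orth d M) B2" unfolding basis_mat_def
  proof (intro conjI ballI impI b2)
    fix x assume "x \<in> carrier_vec q" "B2 *\<^sub>v x = 0\<^sub>v d"
    then show "x = 0\<^sub>v q" by (rule inj2)
  next
    have B0: "B *\<^sub>v (0\<^sub>v r @\<^sub>v z) = B2 *\<^sub>v z" if "z \<in> carrier_vec q" for z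
    proof -
      have "B1 *\<^sub>v 0\<^sub>v r + B2 *\<^sub>v z = B2 *\<^sub>v z" using b1 b2 that by (auto intro!: eq_vecI)
      then show ?thesis unfolding Bs using hcat_mult_vec[OF b1 b2 _ that, of "0\<^sub>v r"] by simp
    qed
    show "L \<inter> orth d M = {B2 *\<^sub>v x |x. x \<in> carrier_vec q \<and> int_vec x}"
    proof (intro equalityI subsetI)
      fix v assume v: "v \<in> L \<inter> orth d M"
      then obtain x where x: "x \<in> carrier_vec (r + q)" "int_vec x" "v = B *\<^sub>v x"
        unfolding basis_matD(3)[OF B] by blast
      obtain y z where yz: "y \<in> carrier_vec r" "z \<in> carrier_vec q" "x = y @\<^sub>v z"
        using vec_append_split[OF x(1)] .
      have ve: "v = B1 *\<^sub>v y + B2 *\<^sub>v z" using x yz hcat_mult_vec[OF b1 b2 yz(1,2)] Bs by simp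
      have vc: "v \<in> carrier_vec d" using x b by simp
      have "H *\<^sub>v y = 0\<^sub>v r" using WB[OF yz(1,2)] ve v orth_iff[OF vc] by simp
      \<comment> \<open>Nonsingularity of \<open>H\<close> confines the orthogonal lattice vectors
        to the combinations of \<open>B2\<close> alone.\<close>
      then have y0: "y = 0\<^sub>v r" using Hnz det_0_iff_vec_prod_zero_field[OF H] yz(1) by blast
      have "z $ i \<in> \<int>" if "i < q" for i
      proof -
        have "x $ (r + i) \<in> \<int>" using x(1,2) that by (simp add: int_vec_def)
        then show ?thesis using yz that by simp
      qed
      then have "int_vec z" using yz by (simp add: int_vec_def)
      then show "v \<in> {B2 *\<^sub>v x |x. x \<in> carrier_vec q \<and> int_vec x}"
        using yz(2,3) x(3) y0 B0[OF yz(2)] by auto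
    next
      fix v assume "v \<in> {B2 *\<^sub>v x |x. x \<in> carrier_vec q \<and> int_vec x}"
      then obtain z where z: "z \<in> carrier_vec q" "int_vec z" "v = B2 *\<^sub>v z" by blast
      have vc: "v \<in> carrier_vec d" using z b2 by simp
      have "int_vec (0\<^sub>v r @\<^sub>v z)" using z by (auto simp: int_vec_def)
      moreover have "0\<^sub>v r @\<^sub>v z \<in> carrier_vec (r + q)" using z by simp
      ultimately have "v \<in> L" using B0[OF z(1)] z(3) unfolding basis_matD(3)[OF B]
        by (metis (mono_tags, lifting) mem_Collect_eq)
      moreover have "W\<^sup>T *\<^sub>v v = 0\<^sub>v r"
      proof -
        have "v = B1 *\<^sub>v 0\<^sub>v r + B2 *\<^sub>v z" using b1 b2 z by (auto intro!: eq_vecI)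
        then have "W\<^sup>T *\<^sub>v v = H *\<^sub>v 0\<^sub>v r" using WB[OF _ z(1), of "0\<^sub>v r"] by simp
        then show ?thesis using H by (auto intro!: eq_vecI)
      qed
      ultimately show "v \<in> L \<inter> orth d M" using orth_iff[OF vc] by simp
    qed
  qed
  show "is_lattice d (L \<inter> orth d M)" by (rule is_latticeI[OF basis2])
  show "lat_rank d (L \<inter> orth d M) = lat_rank d L - lat_rank d M"
    using lat_rank_eq[OF basis2] by (simp add: q_def r_def)
  have "real_of_rat (det ?D) \<le> real_of_rat (det ?G) * real_of_rat (det ?m)"
    using le_det by (metis of_rat_less_eq of_rat_mult)
  then show "lat_det d (L \<inter> orth d M) \<le> lat_det d L * lat_det d M"
    unfolding lat_det_eq[OF basis2] lat_det_eq[OF B] lat_det_eq[OF WM]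
    by (simp add: real_sqrt_mult[symmetric])
qed

subsection \<open>The recursion\<close>

lemma nat_ceiling_div_bounds:
  fixes n k :: nat
  assumes "k \<le> n"
  shows "n - k \<le> 20 * nat \<lceil>(real n - real k) / 20\<rceil>"
    and "20 * nat \<lceil>(real n - real k) / 20\<rceil> < n - k + 20"
proof -
  define s where "s = nat \<lceil>(real n - real k) / 20\<rceil>"
  have "0 \<le> \<lceil>(real n - real k) / 20\<rceil>" using assms by simp
  then have s: "real s = of_int \<lceil>(real n - real k) / 20\<rceil>" by (simp add: s_def)
  have x: "20 * ((real n - real k) / 20) = real n - real k" by simp
  have "real n - real k \<le> 20 * real s"
    unfolding s using le_of_int_ceiling[of "(real n - real k) / 20"] x by linarith
  moreover have "20 * real s < real n - real k + 20"
    unfolding s using of_int_ceiling_le_add_one[of "(real n - real k) / 20"]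
      ceiling_correct[of "(real n - real k) / 20"] x by linarith
  ultimately have "real (n - k) \<le> real (20 * s)" "real (20 * s) < real (n - k + 20)"
    using assms by (auto simp: of_nat_diff)
  then show "n - k \<le> 20 * s" "20 * s < n - k + 20" unfolding of_nat_le_iff of_nat_less_iff .
qed

text \<open>The logarithm of the bound is \<open>l (n - l)\<close> times this quantity, with \<open>A = ln \<alpha>\<close>.\<close>
definition expo :: "real \<Rightarrow> nat \<Rightarrow> nat \<Rightarrow> real" where
  "expo A n t = A + ln 2 * (real n ^ 2 / 2 powr (real t / 2))"

lemma expo_ge: "A \<le> expo A n t"
  by (simp add: expo_def)

text \<open>The difference of the two sides is z times a quadratic form. As z - 2x is not positive,
  x - y may be replaced by x/2; bounding sqrt 2 by 3/2 leaves 5/2 xz - 1/2 x^2 - z^2, which is at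
  most 0 because 10 xz \<le> x^2.\<close>

lemma cubic_step_ineq:
  fixes x y z :: real
  assumes "0 \<le> z" "10 * z \<le> x" "2 * y \<le> x"
  shows "(x - y - z) * (x - z)\<^sup>2 + z * (sqrt 2 * x\<^sup>2) \<le> (x - y) * x\<^sup>2"
proof -
  have sq: "sqrt 2 \<le> 3 / 2" by (rule real_le_lsqrt) (auto simp: power2_eq_square)
  have x: "0 \<le> x" using assms by linarith
  have 1: "(z - 2 * x) * (x - y) \<le> (z - 2 * x) * (x / 2)"
    using assms x by (intro mult_left_mono_neg) auto
  have 2: "sqrt 2 * x\<^sup>2 \<le> 3 / 2 * x\<^sup>2" using sq by (intro mult_right_mono) auto
  have "x * (10 * z) \<le> x * x" using assms x by (intro mult_left_mono) auto
  then have 3: "10 * (x * z) \<le> x * x" by (simp only: mult.left_commute)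
  have "(z - 2 * x) * (x / 2) - x\<^sup>2 + 2 * x * z - z\<^sup>2 + 3 / 2 * x\<^sup>2
      = 5 / 2 * (x * z) - 1 / 2 * (x * x) - z * z"
    by (simp add: algebra_simps power2_eq_square)
  also have "\<dots> \<le> 0" using 3 zero_le_square[of x] zero_le_square[of z] by linarith
  finally have "(z - 2 * x) * (x / 2) - x\<^sup>2 + 2 * x * z - z\<^sup>2 + 3 / 2 * x\<^sup>2 \<le> 0" .
  then have "(z - 2 * x) * (x - y) - x\<^sup>2 + 2 * x * z - z\<^sup>2 + sqrt 2 * x\<^sup>2 \<le> 0"
    using 1 2 by linarith
  then have "z * ((z - 2 * x) * (x - y) - x\<^sup>2 + 2 * x * z - z\<^sup>2 + sqrt 2 * x\<^sup>2) \<le> 0"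
    using assms(1) by (rule mult_nonneg_nonpos[rotated])
  moreover have "(x - y - z) * (x - z)\<^sup>2 + z * (sqrt 2 * x\<^sup>2) - (x - y) * x\<^sup>2
      = z * ((z - 2 * x) * (x - y) - x\<^sup>2 + 2 * x * z - z\<^sup>2 + sqrt 2 * x\<^sup>2)"
    by (simp add: algebra_simps power2_eq_square)
  ultimately show ?thesis by linarith
qed

text \<open>The terms in \<open>A\<close> cancel, since (n - s - l) + s = n - l. Lowering t by one
  multiplies 2^(-t/2) by sqrt 2, so what remains is \<open>cubic_step_ineq\<close> with x = n, y =
  l, z = s.\<close>

lemma expo_recursion:
  assumes "10 * s \<le> n" "2 * l \<le> n" "t \<noteq> 0"
  shows "(real n - real s - real l) * expo A (n - s) t + real s * expo A n (t - 1)
    \<le> (real n - real l) * expo A n t"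
proof -
  define q where "q = 2 powr (real t / 2)"
  have q: "q > 0" by (simp add: q_def)
  have "2 powr (real (t - 1) / 2) = 2 powr (real t / 2 - 1 / 2)"
    using assms(3) by (simp add: of_nat_diff diff_divide_distrib)
  also have "\<dots> = q / sqrt 2" by (simp add: q_def powr_diff powr_half_sqrt)
  finally have q1: "2 powr (real (t - 1) / 2) = q / sqrt 2" .
  have core: "(real n - real l - real s) * (real n - real s)\<^sup>2 + real s * (sqrt 2 * (real n)\<^sup>2)
      \<le> (real n - real l) * (real n)\<^sup>2"
    by (rule cubic_step_ineq) (use assms in linarith)+
  define c where "c = ln 2 / q"
  have "0 \<le> c" using q by (simp add: c_def)
  with core have le: "c * ((real n - real l - real s) * (real n - real s)\<^sup>2 + real s * (sqrt 2 * (real n)\<^sup>2))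
      \<le> c * ((real n - real l) * (real n)\<^sup>2)"
    by (rule mult_left_mono)
  have ns: "real (n - s) = real n - real s" using assms by (simp add: of_nat_diff)
  have e: "ln 2 * (x / q) = c * x" "ln 2 * (x / (q / sqrt 2)) = c * (sqrt 2 * x)" for x
    by (simp_all add: c_def)
  show ?thesis unfolding expo_def q1 q_def[symmetric] ns e
    using le by (simp add: algebra_simps)
qed

text \<open>The shift by one makes the ratio (N' + 1)/(N + 1) at most 20/21 uniformly, and 15 is the
  least integer exponent e with (21/20)^e \<ge> 2.\<close>

lemma count_recursion:
  fixes N N' s :: nat
  assumes "N' = N - s" "N \<le> 20 * s" "s \<le> N" "1 \<le> N"
  shows "2 * (3 * (real N' + 1) ^ 15) \<le> 3 * (real N + 1) ^ 15"
proof -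
  \<comment> \<open>For N \<ge> 20 this follows from s \<ge> N/20; for smaller N it suffices that s
    \<ge> 1.\<close>
  have "21 * (N' + 1) \<le> 20 * (N + 1)" using assms by (cases "N \<ge> 20") auto
  then have "real (21 * (N' + 1)) \<le> real (20 * (N + 1))" by (simp only: of_nat_le_iff)
  then have "21 * (real N' + 1) \<le> 20 * (real N + 1)" by simp
  then have "(21 * (real N' + 1)) ^ 15 \<le> (20 * (real N + 1)) ^ 15" by (intro power_mono) auto
  then have "21 ^ 15 * (real N' + 1) ^ 15 \<le> 20 ^ 15 * (real N + 1) ^ 15"
    unfolding power_mult_distrib .
  moreover have "(2 * 20 ^ 15) * (real N' + 1) ^ 15 \<le> 21 ^ 15 * (real N' + 1) ^ 15"
    by (intro mult_right_mono) auto
  ultimately have "20 ^ 15 * (2 * (real N' + 1) ^ 15) \<le> 20 ^ 15 * (real N + 1) ^ 15" by linarith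
  then have "2 * (real N' + 1) ^ 15 \<le> (real N + 1) ^ 15" by (simp del: power_mult_numeral)
  then show ?thesis by linarith
qed

section \<open>Determinant bounds for a single step, in logarithms\<close>

text \<open>Here \<delta>, \<mu>, \<omega> stand for the logarithms of the determinants of the
  input, of the sublattice of the dual and of the output. The product l (n - l) is symmetric under l
  \<mapsto> n - l, and \<delta> - (1 - l/n) \<delta> = (l/n) \<delta>.\<close>

lemma duality_bound:
  fixes n l :: nat
  assumes ln: "1 \<le> l" "l < n"
    and M: "\<mu> \<le> real (n - l) * (real n - real (n - l)) * e + real (n - l) / real n * (- \<delta>)"
    and out: "\<omega> \<le> \<delta> + \<mu>"
  shows "\<omega> \<le> real l * (real n - real l) * e + real l / real n * \<delta>"
proof -
  have "real (n - l) / real n = 1 - real l / real n" using ln by (simp add: of_nat_diff field_simps)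
  then have "\<mu> \<le> real l * (real n - real l) * e - (1 - real l / real n) * \<delta>"
    using M ln by (simp add: of_nat_diff mult.commute)
  then show ?thesis using out by (simp add: algebra_simps)
qed

text \<open>Here \<nu> is the logarithm of the determinant of the intermediate lattice of rank n -
  s. The weights of \<delta> combine by l/(n - s) * (1 - s/n) = l/n, the factor n - s cancels in the
  contribution of \<mu>, and \<open>expo_recursion\<close> handles the rest.\<close>

lemma recursive_bound:
  fixes n l s t :: nat
  assumes l: "2 * l \<le> n" and s: "s < n" "10 * s \<le> n" and t: "t \<noteq> 0"
    and M: "\<mu> \<le> real s * (real n - real s) * expo A n (t - 1) + real s / real n * (- \<delta>)"
    and out: "\<omega> \<le> real l * (real (n - s) - real l) * expo A (n - s) t + real l / real (n - s) * \<nu>"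
    and \<nu>: "\<nu> \<le> \<delta> + \<mu>"
  shows "\<omega> \<le> real l * (real n - real l) * expo A n t + real l / real n * \<delta>"
proof -
  have ns: "real (n - s) = real n - real s" "real n - real s > 0" using s by (auto simp: of_nat_diff)
  have "real l / real (n - s) * \<nu> \<le> real l / real (n - s) * (\<delta> + \<mu>)"
    using \<nu> by (intro mult_left_mono) auto
  also have "\<dots> \<le> real l / real (n - s) *
      ((1 - real s / real n) * \<delta> + real s * (real n - real s) * expo A n (t - 1))"
    using M by (intro mult_left_mono) (auto simp: algebra_simps)
  also have "\<dots> = real l / real n * \<delta> + real l * (real s * expo A n (t - 1))"
    using ns(2) s unfolding ns(1) by (simp add: field_simps)
  finally have "\<omega> \<le> real l * ((real n - real s - real l) * expo A (n - s) t + real s * expo A n (t - 1))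
      + real l / real n * \<delta>"
    using out unfolding ns(1) by (simp add: algebra_simps)
  also have "real l * ((real n - real s - real l) * expo A (n - s) t + real s * expo A n (t - 1))
      \<le> real l * ((real n - real l) * expo A n t)"
    using expo_recursion[OF s(2) l t] by (intro mult_left_mono) auto
  finally show ?thesis by (simp add: mult.assoc)
qed

section \<open>Correctness and termination of the procedure\<close>

text \<open>The guarantees are stated in logarithms, where both steps of the procedure are linear.
  \<open>A\<close> is to be \<open>ln alpha\<close>, which bounds the logarithm of each factor
  \<open>gamma k l'\<close> by l' (k - l') A.\<close>

locale reduction_oracles =
  fixes k d :: nat and A :: real and Orc LLLf :: "rat vec set \<Rightarrow> nat \<Rightarrow> rat vec set"
  assumes k10: "10 \<le> k" and A: "0 \<le> A"
    and Orc: "\<And>M l'. is_lattice d M \<Longrightarrow> lat_rank d M = k \<Longrightarrow> 1 \<le> l' \<Longrightarrow> l' < k \<Longrightarrow>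
      Orc M l' \<subseteq> M \<and> is_lattice d (Orc M l') \<and> lat_rank d (Orc M l') = l' \<and>
      ln (lat_det d (Orc M l')) \<le> real l' * (real k - real l') * A + real l' / real k * ln (lat_det d M)"
    and LLLf: "\<And>M l'. is_lattice d M \<Longrightarrow> 1 \<le> l' \<Longrightarrow> l' < lat_rank d M \<Longrightarrow>
      LLLf M l' \<subseteq> M \<and> is_lattice d (LLLf M l') \<and> lat_rank d (LLLf M l') = l' \<and>
      ln (lat_det d (LLLf M l')) \<le> real l' * (real (lat_rank d M) - real l') * ln 2
        + real l' / real (lat_rank d M) * ln (lat_det d M)"
begin

lemma orth_step:
  assumes L: "is_lattice d L" and M: "is_lattice d M" "M \<subseteq> dual_lat d L" "lat_rank d M < lat_rank d L"
  shows "is_lattice d (L \<inter> orth d M)"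
    and "lat_rank d (L \<inter> orth d M) = lat_rank d L - lat_rank d M"
    and "ln (lat_det d (L \<inter> orth d M)) \<le> ln (lat_det d L) + ln (lat_det d M)"
proof -
  note o = orth_lattice[OF L M(1,2) less_imp_le[OF M(3)]]
  show 1: "is_lattice d (L \<inter> orth d M)" "lat_rank d (L \<inter> orth d M) = lat_rank d L - lat_rank d M"
    using o by auto
  note pos = lat_det_pos[OF L] lat_det_pos[OF M(1)] lat_det_pos[OF 1(1)]
  have "ln (lat_det d (L \<inter> orth d M)) \<le> ln (lat_det d L * lat_det d M)"
    using o(3) pos by simp
  then show "ln (lat_det d (L \<inter> orth d M)) \<le> ln (lat_det d L) + ln (lat_det d M)"
    using pos by (simp add: ln_mult)
qed

lemma ln_det_dual: "is_lattice d L \<Longrightarrow> ln (lat_det d (dual_lat d L)) = - ln (lat_det d L)"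
  using lat_det_pos[of d L] by (simp add: dual_lattice(3) ln_div)

text \<open>The bound 10 s \<le> n rests on k \<ge> 10: since 20 \<le> 2k, one gets 20 s < n - k +
  20 \<le> n + k < 2n.\<close>

lemma step_size:
  assumes "k < n" "s = nat \<lceil>(real n - real k) / 20\<rceil>"
  shows "1 \<le> s" "s \<le> n - k" "10 * s \<le> n" "n - k \<le> 20 * s"
  using nat_ceiling_div_bounds[of k n] assms k10 by auto

text \<open>Rule induction on the run. The slack added to the count is 2, but 1 for a call that
  opens with a duality step: the extra invocation of that step is paid for by the
  difference.\<close>

lemma Brun_sound:
  assumes "Brun k d Orc LLLf L l t out c"
  shows "is_lattice d L \<Longrightarrow> k \<le> lat_rank d L \<Longrightarrow> 1 \<le> l \<Longrightarrow> l < lat_rank d L \<Longrightarrow>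
    out \<subseteq> L \<and> is_lattice d out \<and> lat_rank d out = l \<and>
    ln (lat_det d out) \<le> real l * (real (lat_rank d L) - real l) * expo A (lat_rank d L) t
      + real l / real (lat_rank d L) * ln (lat_det d L) \<and>
    real c + (if 2 * l > lat_rank d L then 1 else 2) \<le> 2 ^ t * (3 * (real (lat_rank d L - k) + 1) ^ 15)"
  using assms
proof (induction rule: Brun.induct)
  case (duality l L tau M c)
  let ?n = "lat_rank d L"
  note dl = dual_lattice[OF duality.prems(1)]
  \<comment> \<open>Two duality steps never follow each other, so the inner call has slack
    2.\<close>
  have pre: "1 \<le> ?n - l" "?n - l < ?n" "\<not> 2 * (?n - l) > ?n"
    using duality.prems duality.hyps(1) by linarith+
  have IH: "M \<subseteq> dual_lat d L" "is_lattice d M" "lat_rank d M = ?n - l"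
    "ln (lat_det d M) \<le> real (?n - l) * (real ?n - real (?n - l)) * expo A ?n tau
      + real (?n - l) / real ?n * (- ln (lat_det d L))"
    "real c + 2 \<le> 2 ^ tau * (3 * (real (?n - k) + 1) ^ 15)"
    using duality.IH[OF dl(1), unfolded dl(2), OF duality.prems(2) pre(1,2)] pre(3)
    unfolding ln_det_dual[OF duality.prems(1)] by simp_all
  have "lat_rank d M < ?n" using IH(3) duality.prems by simp
  note o = orth_step[OF duality.prems(1) IH(2,1) this]
  show ?case
  proof (intro conjI)
    show "is_lattice d (L \<inter> orth d M)" by (rule o(1))
    show "lat_rank d (L \<inter> orth d M) = l" using o(2) IH(3) duality.prems by simp
    show "ln (lat_det d (L \<inter> orth d M)) \<le> real l * (real ?n - real l) * expo A ?n tau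
      + real l / real ?n * ln (lat_det d L)"
      by (rule duality_bound[OF duality.prems(3,4) IH(4) o(3)])
    show "real (Suc c) + (if 2 * l > ?n then 1 else 2) \<le> 2 ^ tau * (3 * (real (?n - k) + 1) ^ 15)"
      using IH(5) duality.hyps(1) by simp
  qed simp
next
  case (base_oracle l L tau)
  note o = Orc[OF base_oracle.prems(1) base_oracle.hyps(2) base_oracle.prems(3)
      base_oracle.prems(4)[unfolded base_oracle.hyps(2)]]
  have "real l * (real k - real l) * A \<le> real l * (real k - real l) * expo A k tau"
    using expo_ge[of A k tau] base_oracle.prems base_oracle.hyps(2) by (intro mult_left_mono) auto
  then have "ln (lat_det d (Orc L l)) \<le> real l * (real k - real l) * expo A k tau
      + real l / real k * ln (lat_det d L)" using o by linarith
  moreover have "(1::real) * 1 \<le> 2 ^ tau * (real (lat_rank d L - k) + 1) ^ 15"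
    by (intro mult_mono one_le_power) auto
  ultimately show ?case using o base_oracle.hyps by simp
next
  case (base_lll l L tau)
  let ?n = "lat_rank d L"
  \<comment> \<open>At \<open>tau = 0\<close> the denominator in \<open>expo\<close> is 1, so the
    LLL exponent is covered with the factor n^2 to spare.\<close>
  have "ln 2 \<le> expo A ?n tau"
  proof -
    have "1 \<le> real ?n ^ 2" using base_lll.prems by (intro one_le_power) auto
    then have "ln 2 * 1 \<le> ln 2 * real ?n ^ 2" by (intro mult_left_mono) auto
    moreover have "expo A ?n tau = A + ln 2 * real ?n ^ 2" using base_lll.hyps(3) by (simp add: expo_def)
    ultimately show ?thesis using A by linarith
  qed
  then have "real l * (real ?n - real l) * ln 2 \<le> real l * (real ?n - real l) * expo A ?n tau"
    using base_lll.prems by (intro mult_left_mono) auto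
  then have "ln (lat_det d (LLLf L l)) \<le> real l * (real ?n - real l) * expo A ?n tau
      + real l / real ?n * ln (lat_det d L)" using LLLf[OF base_lll.prems(1,3,4)] by linarith
  moreover have "(1::real) * 1 \<le> 2 ^ tau * (real (?n - k) + 1) ^ 15"
    by (intro mult_mono one_le_power) auto
  ultimately show ?case using LLLf[OF base_lll.prems(1,3,4)] base_lll.hyps(1) by simp
next
  case (recursive l L tau ls M c1 out c2)
  let ?n = "lat_rank d L" and ?L' = "L \<inter> orth d M"
  note dl = dual_lattice[OF recursive.prems(1)]
  have kn: "k < ?n" using recursive.prems recursive.hyps(2) by simp
  note s = step_size[OF kn recursive.hyps(4)]
  have sn: "ls < ?n" using s kn k10 by linarith
  have nd: "\<not> 2 * ls > ?n" using s by linarith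
  have IH1: "M \<subseteq> dual_lat d L" "is_lattice d M" "lat_rank d M = ls"
    "ln (lat_det d M) \<le> real ls * (real ?n - real ls) * expo A ?n (tau - 1)
      + real ls / real ?n * (- ln (lat_det d L))"
    "real c1 + 2 \<le> 2 ^ (tau - 1) * (3 * (real (?n - k) + 1) ^ 15)"
    using recursive.IH(1)[OF dl(1), unfolded dl(2), OF recursive.prems(2) s(1) sn] nd
    unfolding ln_det_dual[OF recursive.prems(1)] by simp_all
  have "lat_rank d M < ?n" using IH1(3) sn by simp
  note o = orth_step[OF recursive.prems(1) IH1(2,1) this, unfolded IH1(3)]
  have l: "l < ?n - ls" using s(1,3) recursive.hyps(1) kn k10 by linarith
  have k': "k \<le> ?n - ls" using s(2) kn by linarith
  have IH2: "out \<subseteq> ?L'" "is_lattice d out" "lat_rank d out = l"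
    "ln (lat_det d out) \<le> real l * (real (?n - ls) - real l) * expo A (?n - ls) tau
      + real l / real (?n - ls) * ln (lat_det d ?L')"
    "real c2 + 1 \<le> 2 ^ tau * (3 * (real (?n - ls - k) + 1) ^ 15)"
    using recursive.IH(2) o(1,2) recursive.prems(3) l k' by (auto split: if_splits)
  show ?case
  proof (intro conjI)
    show "out \<subseteq> L" using IH2(1) by blast
    show "ln (lat_det d out) \<le> real l * (real ?n - real l) * expo A ?n tau
      + real l / real ?n * ln (lat_det d L)"
      using recursive_bound[OF _ sn s(3) recursive.hyps(3) IH1(4) IH2(4) o(3)] recursive.hyps(1) by simp
    have "2 * (3 * (real (?n - ls - k) + 1) ^ 15) \<le> 3 * (real (?n - k) + 1) ^ 15"
      by (rule count_recursion[of _ _ ls]) (use s kn in auto)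
    then have "2 ^ (tau - 1) * (2 * (3 * (real (?n - ls - k) + 1) ^ 15)) \<le> 2 ^ (tau - 1) * (3 * (real (?n - k) + 1) ^ 15)"
      by (intro mult_left_mono) auto
    moreover have pow: "2 ^ tau * x = 2 ^ (tau - 1) * (2 * x)" for x :: real
      using recursive.hyps(3) by (cases tau) auto
    \<comment> \<open>The two branches each fit into half of the budget. Slack 2 of the first and at
      least 1 of the second give 3: one for the current invocation and two for its own
      slack.\<close>
    ultimately have "real c1 + real c2 + 3 \<le> 2 ^ tau * (3 * (real (?n - k) + 1) ^ 15)"
      using IH1(5) IH2(5) unfolding pow by linarith
    then show "real (Suc (c1 + c2)) + (if 2 * l > ?n then 1 else 2)
        \<le> 2 ^ tau * (3 * (real (?n - k) + 1) ^ 15)"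
      using recursive.hyps(1) by simp
  qed (use IH2 in auto)
qed

text \<open>Lexicographic induction on (t, rank): the first recursive call lowers t, the second
  keeps t and lowers the rank. A duality step changes neither, so it is treated outside the
  induction hypothesis.\<close>

lemma Brun_exists:
  "is_lattice d L \<Longrightarrow> k \<le> lat_rank d L \<Longrightarrow> 1 \<le> l \<Longrightarrow> l < lat_rank d L \<Longrightarrow>
    \<exists>out c. Brun k d Orc LLLf L l t out c"
proof (induction "(t, lat_rank d L)" arbitrary: t L l
    rule: wf_induct_rule[OF wf_lex_prod[OF wf_less_than wf_less_than]])
  case (1 t L l)
  let ?n = "lat_rank d L"
  \<comment> \<open>Stated for every lattice of the given rank, so that it also covers the dual
    lattice reached by a duality step.\<close>
  have nondual: "\<exists>out c. Brun k d Orc LLLf L l t out c"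
    if L: "is_lattice d L" and n: "lat_rank d L = ?n" and l: "1 \<le> l" "\<not> 2 * l > ?n" for L l
  proof -
    consider "?n = k" | "?n \<noteq> k" "t = 0" | "k < ?n" "t \<noteq> 0" using "1.prems"(2) by linarith
    then show ?thesis
    proof cases
      case 1
      then show ?thesis using Brun.base_oracle[of d L l k] l n by metis
    next
      case 2
      then show ?thesis using Brun.base_lll[of d L l k t] l n by metis
    next
      case 3
      define s where "s = nat \<lceil>(real ?n - real k) / 20\<rceil>"
      note s = step_size[OF 3(1) s_def]
      note dl = dual_lattice[OF L]
      have sn: "s < ?n" using s 3 k10 by linarith
      obtain M c1 where M: "Brun k d Orc LLLf (dual_lat d L) s (t - 1) M c1"
        using "1.hyps"[OF _ dl(1), of "t - 1" s] s(1) sn dl(2) n "1.prems" 3(2) by auto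
      \<comment> \<open>Soundness of the first call provides the rank of \<open>M\<close>, hence the
        drop in rank for the second call.\<close>
      then have Ms: "is_lattice d M" "M \<subseteq> dual_lat d L" "lat_rank d M = s"
        using Brun_sound[OF M dl(1)] s(1) sn dl(2) n "1.prems" by auto
      then have "lat_rank d M < lat_rank d L" using sn n by simp
      note o = orth_step[OF L Ms(1,2) this]
      have r: "lat_rank d (L \<inter> orth d M) = ?n - s" using o(2) Ms(3) n by simp
      have "l < ?n - s" "k \<le> ?n - s" using s(1,2,3) l 3(1) k10 by linarith+
      then obtain out c2 where "Brun k d Orc LLLf (L \<inter> orth d M) l t out c2"
        using "1.hyps"[OF _ o(1), of t l] r l(1) s(1,2) sn 3(1) by auto
      then show ?thesis
        using Brun.recursive[of d L l k t s Orc LLLf M c1 out c2] M l n 3 s_def by auto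
    qed
  qed
  show ?case
  proof (cases "2 * l > ?n")
    case False
    then show ?thesis using nondual[OF "1.prems"(1) refl "1.prems"(3)] by blast
  next
    case True
    note dl = dual_lattice[OF "1.prems"(1)]
    have l: "1 \<le> ?n - l" "\<not> 2 * (?n - l) > ?n" using True "1.prems"(4) by linarith+
    obtain M c where "Brun k d Orc LLLf (dual_lat d L) (?n - l) t M c"
      using nondual[OF dl(1,2), of "?n - l"] l by auto
    then show ?thesis using Brun.duality[OF True] by blast
  qed
qed

end

section \<open>From logarithms back to determinants\<close>

theorem mainTheorem4:
  "\<exists>p :: real poly. \<forall>(k::nat) (gamma :: nat \<Rightarrow> nat \<Rightarrow> real)
      (Orc :: rat vec set \<Rightarrow> nat \<Rightarrow> rat vec set) (LLLf :: rat vec set \<Rightarrow> nat \<Rightarrow> rat vec set)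
      (d::nat) (L :: rat vec set) (l::nat) (tau::nat).
     k \<ge> 10 \<longrightarrow>
     (\<forall>l'. 1 \<le> l' \<and> l' < k \<longrightarrow> gamma k l' \<ge> 1) \<longrightarrow>
     (\<forall>M l'. is_lattice d M \<and> lat_rank d M = k \<and> 1 \<le> l' \<and> l' < k \<longrightarrow>
        Orc M l' \<subseteq> M \<and> is_lattice d (Orc M l') \<and> lat_rank d (Orc M l') = l' \<and>
        lat_det d (Orc M l') \<le> gamma k l' * lat_det d M powr (real l' / real k)) \<longrightarrow>
     (\<forall>M l'. is_lattice d M \<and> 1 \<le> l' \<and> l' < lat_rank d M \<longrightarrow>
        LLLf M l' \<subseteq> M \<and> is_lattice d (LLLf M l') \<and> lat_rank d (LLLf M l') = l' \<and>
        lat_det d (LLLf M l') \<le> 2 powr (real (l' * (lat_rank d M - l'))) *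
                                   lat_det d M powr (real l' / real (lat_rank d M))) \<longrightarrow>
     is_lattice d L \<longrightarrow> lat_rank d L \<ge> k \<longrightarrow> 1 \<le> l \<longrightarrow> l < lat_rank d L \<longrightarrow>
     (let n = lat_rank d L;
          alpha = Max ((\<lambda>l'. gamma k l' powr (1 / real (l' * (k - l')))) ` {1..<k})
      in (\<exists>out cnt. Brun k d Orc LLLf L l tau out cnt) \<and>
         (\<forall>out cnt. Brun k d Orc LLLf L l tau out cnt \<longrightarrow>
            real cnt \<le> poly p (real n) * 2 ^ tau \<and>
            out \<subseteq> L \<and> is_lattice d out \<and> lat_rank d out = l \<and>
            lat_det d out / lat_det d L powr (real l / real n)
              \<le> alpha powr (real (l * (n - l))) *
                 2 powr (real (l * (n - l)) * real n ^ 2 / 2 powr (real tau / 2))))"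
proof (rule exI[of _ "smult 3 ([:1, 1:] ^ 15)"], intro allI impI, goal_cases)
  case (1 k gamma Orc LLLf d L l tau)
  note k10 = 1(1) and gamma = 1(2) and L = 1(5) and kn = 1(6) and l = 1(7,8)
  define n where "n = lat_rank d L"
  define alpha where "alpha = Max ((\<lambda>l'. gamma k l' powr (1 / real (l' * (k - l')))) ` {1..<k})"
  have alpha_ge: "gamma k l' powr (1 / real (l' * (k - l'))) \<le> alpha" if "1 \<le> l'" "l' < k" for l'
    unfolding alpha_def by (rule Max_ge) (use that in auto)
  \<comment> \<open>The term for l' = 1 already shows that \<open>alpha\<close> is at least 1, so
    \<open>ln alpha\<close> is nonnegative as the locale demands.\<close>
  have "1 \<le> gamma k 1 powr (1 / real (1 * (k - 1)))" using gamma k10 by (intro ge_one_powr_ge_zero) auto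
  also have "\<dots> \<le> alpha" by (rule alpha_ge) (use k10 in auto)
  finally have alpha1: "1 \<le> alpha" .
  have ln_gamma: "ln (gamma k l') \<le> real l' * (real k - real l') * ln alpha" if l': "1 \<le> l'" "l' < k" for l'
  proof -
    have g: "1 \<le> gamma k l'" using gamma l' by blast
    have p: "real (l' * (k - l')) > 0" using l' by simp
    have "ln (gamma k l' powr (1 / real (l' * (k - l')))) \<le> ln alpha"
      using alpha_ge[OF l'] g by (intro ln_mono) auto
    then have "ln (gamma k l') / real (l' * (k - l')) \<le> ln alpha"
      using g by (simp add: ln_powr)
    then have "ln (gamma k l') \<le> ln alpha * real (l' * (k - l'))" using p by (simp only: pos_divide_le_eq)
    then show ?thesis using l' by (simp add: of_nat_diff mult.commute)
  qed
  have Orc: "Orc M l' \<subseteq> M \<and> is_lattice d (Orc M l') \<and> lat_rank d (Orc M l') = l' \<and>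
      ln (lat_det d (Orc M l')) \<le> real l' * (real k - real l') * ln alpha + real l' / real k * ln (lat_det d M)"
    if M: "is_lattice d M" "lat_rank d M = k" "1 \<le> l'" "l' < k" for M l'
  proof -
    have o: "Orc M l' \<subseteq> M" "is_lattice d (Orc M l')" "lat_rank d (Orc M l') = l'"
      "lat_det d (Orc M l') \<le> gamma k l' * lat_det d M powr (real l' / real k)"
      using 1(3) M by auto
    have g: "1 \<le> gamma k l'" using gamma M by blast
    note pos = lat_det_pos[OF o(2)] lat_det_pos[OF M(1)]
    have "ln (lat_det d (Orc M l')) \<le> ln (gamma k l' * lat_det d M powr (real l' / real k))"
      by (intro ln_mono) (use o(4) pos in auto)
    also have "\<dots> = ln (gamma k l') + real l' / real k * ln (lat_det d M)"
      using g pos by (simp add: ln_mult ln_powr)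
    finally show ?thesis using o ln_gamma[OF M(3,4)] by simp
  qed
  have LLLf: "LLLf M l' \<subseteq> M \<and> is_lattice d (LLLf M l') \<and> lat_rank d (LLLf M l') = l' \<and>
      ln (lat_det d (LLLf M l')) \<le> real l' * (real (lat_rank d M) - real l') * ln 2
        + real l' / real (lat_rank d M) * ln (lat_det d M)"
    if M: "is_lattice d M" "1 \<le> l'" "l' < lat_rank d M" for M l'
  proof -
    have o: "LLLf M l' \<subseteq> M" "is_lattice d (LLLf M l')" "lat_rank d (LLLf M l') = l'"
      "lat_det d (LLLf M l') \<le> 2 powr (real (l' * (lat_rank d M - l'))) *
         lat_det d M powr (real l' / real (lat_rank d M))"
      using 1(4) M by auto
    note pos = lat_det_pos[OF o(2)] lat_det_pos[OF M(1)]
    have "ln (lat_det d (LLLf M l')) \<le> ln (2 powr (real (l' * (lat_rank d M - l'))) *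
         lat_det d M powr (real l' / real (lat_rank d M)))"
      by (intro ln_mono) (use o(4) pos in auto)
    also have "\<dots> = real l' * (real (lat_rank d M) - real l') * ln 2
        + real l' / real (lat_rank d M) * ln (lat_det d M)"
      using M pos by (simp add: ln_mult ln_powr of_nat_diff)
    finally show ?thesis using o by simp
  qed
  interpret reduction_oracles k d "ln alpha" Orc LLLf
    by unfold_locales (use k10 alpha1 Orc LLLf in auto)
  show ?case
    unfolding Let_def n_def[symmetric] alpha_def[symmetric]
  proof (intro conjI allI impI)
    show "\<exists>out cnt. Brun k d Orc LLLf L l tau out cnt" by (rule Brun_exists[OF L kn l])
  next
    fix out cnt assume run: "Brun k d Orc LLLf L l tau out cnt"
    note s = Brun_sound[OF run L kn l, folded n_def]
    show "out \<subseteq> L" "is_lattice d out" "lat_rank d out = l" using s by blast+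
    have "real cnt \<le> 2 ^ tau * (3 * (real (n - k) + 1) ^ 15)" using s by (auto split: if_splits)
    \<comment> \<open>Passing from n - k to n makes the polynomial 3 (1 + X)^15 independent of
      k.\<close>
    also have "\<dots> \<le> 2 ^ tau * (3 * (real n + 1) ^ 15)"
      by (intro mult_left_mono power_mono) auto
    also have "\<dots> = poly (smult 3 ([:1, 1:] ^ 15)) (real n) * 2 ^ tau"
      by (simp add: poly_power add.commute)
    finally show "real cnt \<le> poly (smult 3 ([:1, 1:] ^ 15)) (real n) * 2 ^ tau" .
    let ?E = "alpha powr real (l * (n - l)) * 2 powr (real (l * (n - l)) * (real n)\<^sup>2 / 2 powr (real tau / 2))"
    have out: "is_lattice d out" using s by blast
    note pos = lat_det_pos[OF out] lat_det_pos[OF L]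
    have "real l * (real n - real l) * expo (ln alpha) n tau = ln ?E"
      using l alpha1 by (simp add: ln_mult ln_powr expo_def n_def of_nat_diff algebra_simps)
    moreover have "ln (lat_det d out) \<le> real l * (real n - real l) * expo (ln alpha) n tau
        + real l / real n * ln (lat_det d L)" using s by blast
    ultimately have "ln (lat_det d out) \<le> ln ?E + ln (lat_det d L powr (real l / real n))"
      using pos by (simp add: ln_powr)
    also have "\<dots> = ln (?E * lat_det d L powr (real l / real n))"
      using pos alpha1 by (subst ln_mult) auto
    finally have "lat_det d out \<le> ?E * lat_det d L powr (real l / real n)"
      using pos alpha1 by (subst (asm) ln_le_cancel_iff) auto
    then show "lat_det d out / lat_det d L powr (real l / real n) \<le> ?E"
      using pos by (simp add: pos_divide_le_eq)
  qed
qed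

end
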